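(* Let $\mathbb{K}$ be an algebraically closed field of characteristic $0$, $R=\mathbb{K}[x_0,\dots,x_n]$, and let $F=\ell_0^{a_0}\cdots\ell_k^{a_k}\cdot q\in R$ be a concise form, where $\ell_0,\dots,\ell_k\in R_1$ are pairwise non-proportional nonzero linear forms, $a_0,\dots,a_k$ are positive integers and $q\in R_2$ is a quadratic form, so that $\deg(F)=a_0+\cdots+a_k+2$. Let $\mathcal{L}=\mathbb{P}(\langle \ell_0^\vee,\dots,\ell_k^\vee\rangle)\subset\mathbb{P}^n$ and assume that $\dim\mathcal{L}=k<n$. Assume that $F$ satisfies the following two conditions. (a) For every $2\le i\le \deg(F)-1$ and all nonzero linear forms $H_1,\dots,H_i\in S_1$ with $H_i\cdots H_1\in\mathrm{Ann}(F)$: if $\mathcal{L}\subset \mathrm{V}(H_i)$, then $H_{i-1}\cdots H_1[\ell_0^{a_0}\cdots\ell_k^{a_k}]=0$. (b) If $\dim\mathcal{L}>0$, then for every nonzero linear form $H\in S_1$ with $\mathcal{L}\subset\mathrm{V}(H)$ one has $H[q]^\vee\notin\mathcal{L}$. Then: if $\dim\mathcal{L}=0$, then $\mathrm{srk}(F)\ge(\deg(F)-1)n$; and if $\dim\mathcal{L}>0$, then $\mathrm{srk}(F)\ge\deg(F)(n-k)$.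
   Context: The ring $S=\mathbb{K}[y_0,\dots,y_n]$ acts on $R=\mathbb{K}[x_0,\dots,x_n]$ by differentiation, $y_i[F]=\partial F/\partial x_i$, and $\mathrm{Ann}(F)=\{\delta\in S\mid\delta[F]=0\}$. A form $F\in R$ is concise if $\mathrm{Ann}(F)_1=0$. For a nonzero linear form $\ell=a_0x_0+\cdots+a_nx_n$, $\ell^\vee=(a_0:\cdots:a_n)\in\mathbb{P}^n$ is the dual point. For $H\in S_1$, $\mathrm{V}(H)\subset\mathbb{P}^n$ is its zero locus, so $H[\ell]=0$ iff $\ell^\vee\in\mathrm{V}(H)$. (If $H\neq0$ and $\mathcal{L}\subset\mathrm{V}(H)$, conciseness of $F$ guarantees that the linear form $H[q]$ is nonzero, so $H[q]^\vee$ is defined.) All dimensions are projective. The symmetric (Waring) rank $\mathrm{srk}(F)$ of a form $F$ of degree $d$ is the minimal $r$ such that there are linear forms $m_1,\dots,m_r\in R_1$ with $F\in\langle m_1^d,\dots,m_r^d\rangle$. *)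

theory Defs
  imports
    "HOL-Library.Poly_Mapping"
    "HOL-Library.Extended_Nat"
    "HOL-Computational_Algebra.Polynomial"
begin

(* A monomial is its finitely supported exponent vector, a polynomial the finitely supported
   family of its coefficients. The rings R and S are two copies of the polynomial ring in the
   variables with indices 0, ..., n. *)
type_synonym monom = "nat \<Rightarrow>\<^sub>0 nat"
type_synonym 'k mpoly = "monom \<Rightarrow>\<^sub>0 'k"

definition poly_ring :: "nat \<Rightarrow> 'k::comm_ring_1 mpoly set" where
  "poly_ring n = {p. \<forall>m\<in>Poly_Mapping.keys p. Poly_Mapping.keys m \<subseteq> {..n}}"

definition mon_deg :: "monom \<Rightarrow> nat" where
  "mon_deg m = (\<Sum>i\<in>Poly_Mapping.keys m. Poly_Mapping.lookup m i)"

(* total degree, with value 0 at the zero polynomial *)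
definition tdeg :: "'k::comm_ring_1 mpoly \<Rightarrow> nat" where
  "tdeg p = Max (insert 0 (mon_deg ` Poly_Mapping.keys p))"

definition forms :: "nat \<Rightarrow> nat \<Rightarrow> 'k::comm_ring_1 mpoly set" where
  "forms n d = {p \<in> poly_ring n. \<forall>m\<in>Poly_Mapping.keys p. mon_deg m = d}"

definition evalp :: "(nat \<Rightarrow>\<^sub>0 'k) \<Rightarrow> 'k::comm_ring_1 mpoly \<Rightarrow> 'k" where
  "evalp v p = (\<Sum>m\<in>Poly_Mapping.keys p. Poly_Mapping.lookup p m *
     (\<Prod>i\<in>Poly_Mapping.keys m. Poly_Mapping.lookup v i ^ Poly_Mapping.lookup m i))"

(* used for polynomials as well as for vectors of coordinates *)
definition scale :: "'k::field \<Rightarrow> ('a \<Rightarrow>\<^sub>0 'k) \<Rightarrow> ('a \<Rightarrow>\<^sub>0 'k)" where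
  "scale c p = Poly_Mapping.map ((*) c) p"

lemma lookup_scale [simp]: "Poly_Mapping.lookup (scale c p) x = c * Poly_Mapping.lookup p x"
  by (simp add: scale_def Poly_Mapping.map.rep_eq when_def)

interpretation pm: vector_space scale
  by unfold_locales (auto intro!: poly_mapping_eqI simp: lookup_add algebra_simps)

(* The truncated subtraction is harmless: if i does not occur in m, the coefficient is 0. *)
definition partial :: "nat \<Rightarrow> 'k::comm_ring_1 mpoly \<Rightarrow> 'k mpoly" where
  "partial i p = (\<Sum>m\<in>Poly_Mapping.keys p.
     Poly_Mapping.single (m - Poly_Mapping.single i 1)
       (of_nat (Poly_Mapping.lookup m i) * Poly_Mapping.lookup p m))"

definition mon_act :: "monom \<Rightarrow> 'k::comm_ring_1 mpoly \<Rightarrow> 'k mpoly" where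
  "mon_act m = foldr (\<lambda>i. partial i ^^ Poly_Mapping.lookup m i)
     (sorted_list_of_set (Poly_Mapping.keys m))"

definition act :: "'k::field mpoly \<Rightarrow> 'k mpoly \<Rightarrow> 'k mpoly" where
  "act D p = (\<Sum>m\<in>Poly_Mapping.keys D. scale (Poly_Mapping.lookup D m) (mon_act m p))"

definition Ann :: "nat \<Rightarrow> 'k::field mpoly \<Rightarrow> 'k mpoly set" where
  "Ann n F = {D \<in> poly_ring n. act D F = 0}"

definition concise :: "nat \<Rightarrow> 'k::field mpoly \<Rightarrow> bool" where
  "concise n F \<longleftrightarrow> Ann n F \<inter> forms n 1 = {0}"

(* A projective point is the set of its homogeneous coordinate vectors (all of them nonzero);
   subsets of projective space are sets of points, and the union of such a set is the
   corresponding affine cone without the origin. *)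
type_synonym 'k ppoint = "(nat \<Rightarrow>\<^sub>0 'k) set"

definition ppt :: "(nat \<Rightarrow>\<^sub>0 'k::field) \<Rightarrow> 'k ppoint" where
  "ppt v = {scale c v | c. c \<noteq> 0}"

definition proj_space :: "nat \<Rightarrow> 'k::field ppoint set" where
  "proj_space n = {ppt v | v. v \<noteq> 0 \<and> Poly_Mapping.keys v \<subseteq> {..n}}"

definition proj_span :: "'k::field ppoint set \<Rightarrow> 'k ppoint set" where
  "proj_span X = ppt ` (pm.span (\<Union>X) - {0})"

definition pdim :: "'k::field ppoint set \<Rightarrow> int" where
  "pdim X = int (pm.dim (\<Union>X)) - 1"

definition zero_locus :: "nat \<Rightarrow> 'k::field mpoly \<Rightarrow> 'k ppoint set" where
  "zero_locus n H = {P \<in> proj_space n. \<forall>v\<in>P. evalp v H = 0}"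

(* The i-th coordinate is the coefficient of the variable with index i. Only meaningful for
   nonzero linear forms; dual_pt 0 is {0}, which is not a point of any projective space. *)
definition dual_pt :: "'k::field mpoly \<Rightarrow> 'k ppoint" where
  "dual_pt l = ppt (Poly_Mapping.map_key (\<lambda>i. Poly_Mapping.single i 1) l)"

(* For a form of degree tdeg F; the infimum is infinity if there is no decomposition. *)
definition srk :: "nat \<Rightarrow> 'k::field mpoly \<Rightarrow> enat" where
  "srk n F = Inf {enat r | r. \<exists>m. (\<forall>i<r. m i \<in> forms n 1) \<and>
     F \<in> pm.span ((\<lambda>i. m i ^ tdeg F) ` {..<r})}"

end

(* Let F = A q with A the product of the powers of the l_i, s = n - k, and suppose F is a linear
   combination of d-th powers of points m_i, d = deg F. A derivative of F is a combination of
   powers of those m_i that the direction does not annihilate.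

   k = 0: among the remaining points there are always n that are independent modulo l_0, because a
   direction h annihilating l_0 and all remaining points would annihilate the current derivative G
   of F, whereas h[G] = l_0^b p with a nonzero linear form p. Differentiate along the direction that is 1 on l_0 and vanishes on these
   n points: they are removed, and this can be done d - 1 times.

   k > 0: let W be the space of all h[q] with h vanishing on the l_i. Condition (b) says that h[q]
   lies in the span of the l_i only for h = 0, so dim W = s and W meets that span in 0. Let D_e be
   the span of the e-th powers of the points outside the span of the l_i, and t a direction that
   vanishes on the l_i but at none of these points. Then t maps D_(e+1) onto D_e, hence dim D_(d-1)
   is at least the sum of the dimensions of the kernels of t on D_e, e < d. Since D_(d-1) contains
   A W, the kernel on D_e contains the divisors of A of degree e and the products p w with p a
   divisor of A of degree e - 1 and w in the at least (s - 1)-dimensional kernel of t on W.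
   Altogether this gives s times the number of monomials in the l_i dividing A, which is at least
   s d: one in each degree 0, ..., d - 2, and a second one, l_1 beside l_0, in degree 1. *)

theory Submission
  imports Defs
begin

interpretation pp: vector_space_pair "scale :: 'k::field \<Rightarrow> ('a \<Rightarrow>\<^sub>0 'k) \<Rightarrow> _" "scale :: 'k \<Rightarrow> ('b \<Rightarrow>\<^sub>0 'k) \<Rightarrow> _" ..

interpretation sc: vector_space "(*) :: 'k::field \<Rightarrow> 'k \<Rightarrow> 'k"
  by unfold_locales (auto simp: algebra_simps)

interpretation ps: vector_space_pair "scale :: 'k::field \<Rightarrow> ('a \<Rightarrow>\<^sub>0 'k) \<Rightarrow> _" "(*) :: 'k \<Rightarrow> 'k \<Rightarrow> 'k" ..

abbreviation var :: "nat \<Rightarrow> monom" where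
  "var i \<equiv> Poly_Mapping.single i 1"

section \<open>Formal partial derivatives in terms of coefficients\<close>

lemma lookup_sum_pm: "Poly_Mapping.lookup (sum f A) x = (\<Sum>i\<in>A. Poly_Mapping.lookup (f i) x)"
  by (induction A rule: infinite_finite_induct) (auto simp: lookup_add)

lemma var_diff_eq_iff:
  assumes "Poly_Mapping.lookup m i \<noteq> 0"
  shows "m - var i = m' \<longleftrightarrow> m = m' + var i"
proof
  assume "m - var i = m'"
  then show "m = m' + var i"
    using assms by (auto intro!: poly_mapping_eqI simp: lookup_add lookup_minus lookup_single when_def)
next
  assume "m = m' + var i"
  then show "m - var i = m'" by simp
qed

text \<open>Only the monomial \<open>m + var i\<close> contributes to the coefficient at
  \<open>m\<close>. With this formula linearity and commutation of derivatives become comparisons of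
  coefficients.\<close>

lemma lookup_partial:
  "Poly_Mapping.lookup (partial i p) m =
     of_nat (Suc (Poly_Mapping.lookup m i)) * Poly_Mapping.lookup p (m + var i)"
proof -
  have "Poly_Mapping.lookup (partial i p) m =
    (\<Sum>m'\<in>Poly_Mapping.keys p. if m' = m + var i
       then of_nat (Poly_Mapping.lookup m' i) * Poly_Mapping.lookup p m' else 0)"
    unfolding partial_def lookup_sum_pm
  proof (rule sum.cong[OF refl])
    fix m'
    \<comment> \<open>If \<open>i\<close> does not occur in \<open>m'\<close>, truncated subtraction
      leaves \<open>m'\<close> unchanged, but the factor \<open>lookup m' i\<close> is then
      0.\<close>
    have eq: "Poly_Mapping.lookup m' i \<noteq> 0 \<Longrightarrow> m' - var i = m \<longleftrightarrow> m' = m + var i"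
      by (rule var_diff_eq_iff)
    show "Poly_Mapping.lookup (Poly_Mapping.single (m' - var i)
        (of_nat (Poly_Mapping.lookup m' i) * Poly_Mapping.lookup p m')) m =
      (if m' = m + var i then of_nat (Poly_Mapping.lookup m' i) * Poly_Mapping.lookup p m' else 0)"
      by (cases "Poly_Mapping.lookup m' i = 0")
        (auto simp del: One_nat_def simp: lookup_single when_def eq lookup_add)
  qed
  also have "\<dots> = of_nat (Suc (Poly_Mapping.lookup m i)) * Poly_Mapping.lookup p (m + var i)"
    by (auto simp: sum.delta lookup_add lookup_single in_keys_iff)
  finally show ?thesis .
qed

lemma partial_add: "partial i (p + q) = partial i p + partial i q"
  by (rule poly_mapping_eqI) (simp add: lookup_partial lookup_add algebra_simps)

lemma partial_scale: "partial i (scale c p) = scale c (partial i p)"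
  by (rule poly_mapping_eqI) (simp only: lookup_partial lookup_scale mult.left_commute)

lemma partial_sum: "partial i (sum f A) = (\<Sum>x\<in>A. partial i (f x))"
  by (rule poly_mapping_eqI) (simp add: lookup_partial lookup_sum_pm sum_distrib_left)

lemma partial_commute: "partial i (partial j p) = partial j (partial i p)"
  by (rule poly_mapping_eqI)
    (auto simp: lookup_partial lookup_add lookup_single when_def add_ac)

lemma partial_single:
  "partial i (Poly_Mapping.single m c) =
     Poly_Mapping.single (m - var i) (of_nat (Poly_Mapping.lookup m i) * c)"
  by (cases "c = 0") (auto simp: partial_def)

lemma partial_mult_single:
  "partial i (Poly_Mapping.single m c * Poly_Mapping.single m' c') =
     partial i (Poly_Mapping.single m c) * Poly_Mapping.single m' c' +
     Poly_Mapping.single m c * partial i (Poly_Mapping.single m' c')"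
proof -
  have A: "m - var i + m' = m + m' - var i" if "Poly_Mapping.lookup m i \<noteq> 0" for m m' :: monom
    using that by (auto intro!: poly_mapping_eqI simp: lookup_add lookup_minus lookup_single when_def)
  show ?thesis
    using A[of m m'] A[of m' m]
    by (cases "Poly_Mapping.lookup m i = 0"; cases "Poly_Mapping.lookup m' i = 0")
      (auto simp: partial_single mult_single lookup_add algebra_simps single_add[symmetric])
qed

lemma pm_as_sum: "p = (\<Sum>m\<in>Poly_Mapping.keys p. Poly_Mapping.single m (Poly_Mapping.lookup p m))"
  by (rule poly_mapping_eqI) (auto simp: lookup_sum_pm lookup_single when_def in_keys_iff sum.delta')

text \<open>Both sides are bilinear in \<open>p\<close> and \<open>q\<close>, so the Leibniz rule
  reduces to monomials.\<close>

lemma partial_mult: "partial i (p * q) = partial i p * q + p * partial i q"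
proof -
  define P where "P m = Poly_Mapping.single m (Poly_Mapping.lookup p m)" for m
  define Q where "Q m = Poly_Mapping.single m (Poly_Mapping.lookup q m)" for m
  have p: "p = sum P (Poly_Mapping.keys p)" and q: "q = sum Q (Poly_Mapping.keys q)"
    unfolding P_def Q_def by (rule pm_as_sum)+
  have "partial i (sum P A * sum Q B) = partial i (sum P A) * sum Q B + sum P A * partial i (sum Q B)" for A B
    unfolding sum_product partial_sum
    by (simp add: P_def Q_def partial_mult_single sum.distrib)
  then show ?thesis using p q by metis
qed

lemma scale_eq_mult: "scale c (p :: 'k::field mpoly) = Poly_Mapping.single 0 c * p"
proof (rule poly_mapping_eqI)
  fix m
  have "Poly_Mapping.single 0 c * p =
     (\<Sum>m\<in>Poly_Mapping.keys p. Poly_Mapping.single m (c * Poly_Mapping.lookup p m))"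
    by (subst (1) pm_as_sum[of p]) (simp add: sum_distrib_left mult_single)
  then show "Poly_Mapping.lookup (scale c p) m = Poly_Mapping.lookup (Poly_Mapping.single 0 c * p) m"
    by (auto simp: lookup_sum_pm lookup_single when_def in_keys_iff sum.delta')
qed

lemma scale_mult_left: "scale c p * (q :: 'k::field mpoly) = scale c (p * q)"
  by (simp add: scale_eq_mult mult.assoc)

lemma scale_mult_right: "(p :: 'k::field mpoly) * scale c q = scale c (p * q)"
  by (simp add: scale_eq_mult mult.left_commute)

section \<open>Directional derivatives\<close>

text \<open>The derivative in direction \<open>c\<close>, i.e. the action of the linear form with coefficients \<open>c\<close>;
  \<open>lc\<close> is its value on linear forms, read off as a scalar.\<close>

definition dd :: "nat \<Rightarrow> (nat \<Rightarrow> 'k) \<Rightarrow> 'k::field mpoly \<Rightarrow> 'k mpoly" where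
  "dd n c p = (\<Sum>i\<le>n. scale (c i) (partial i p))"

definition lc :: "nat \<Rightarrow> (nat \<Rightarrow> 'k) \<Rightarrow> 'k::field mpoly \<Rightarrow> 'k" where
  "lc n c p = (\<Sum>i\<le>n. c i * Poly_Mapping.lookup p (var i))"

lemma dd_add: "dd n c (p + q) = dd n c p + dd n c q"
  by (simp add: dd_def partial_add pm.scale_right_distrib sum.distrib)

lemma dd_scale: "dd n c (scale r p) = scale r (dd n c p)"
  by (simp add: dd_def partial_scale pm.scale_sum_right mult.commute)

lemma linear_dd: "Vector_Spaces.linear scale scale (dd n c)"
  by (rule Vector_Spaces.linear_iff[THEN iffD2]) (simp add: dd_add dd_scale pm.vector_space_axioms)

lemma dd_0 [simp]: "dd n c 0 = 0"
  by (rule pp.linear_0[OF linear_dd])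

lemma dd_mult: "dd n c (p * q) = dd n c p * q + p * dd n c q"
  by (simp add: dd_def partial_mult pm.scale_right_distrib sum.distrib sum_distrib_right
      sum_distrib_left scale_mult_left scale_mult_right)

lemma dd_commute: "dd n c (dd n c' p) = dd n c' (dd n c p)"
  unfolding dd_def partial_sum partial_scale pm.scale_sum_right
  by (subst sum.swap) (simp add: partial_commute mult.commute)

lemma dd_one [simp]: "dd n c 1 = 0"
  \<comment> \<open>The product rule for 1 * 1 makes this derivative equal to twice itself.\<close>
  using dd_mult[of n c 1 1] by (metis add_cancel_right_right mult_1_left mult_1_right)

text \<open>At \<open>d = 0\<close> the exponent \<open>d - 1\<close> truncates to 0, but the factor
  \<open>of_nat d\<close> vanishes.\<close>

lemma dd_power: "dd n c (p ^ d) = scale (of_nat d) (p ^ (d - 1) * dd n c p)"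
proof (induction d)
  case (Suc d)
  show ?case
  proof (cases d)
    case (Suc e)
    then have "p * dd n c (p ^ d) = scale (of_nat d) (p ^ d * dd n c p)"
      using Suc.IH by (simp add: scale_mult_right mult.assoc)
    then show ?thesis
      by (simp add: dd_mult pm.scale_left_distrib mult.commute)
  qed (simp add: dd_mult)
qed simp

lemma dd_prod_eq_0:
  assumes "\<And>i. i \<in> A \<Longrightarrow> dd n c (f i) = 0"
  shows "dd n c (prod f A) = 0"
  using assms by (induction A rule: infinite_finite_induct) (auto simp: dd_mult)

lemma dd_add_direction: "dd n (\<lambda>i. c i + c' i) p = dd n c p + dd n c' p"
  by (simp add: dd_def pm.scale_left_distrib sum.distrib)

lemma dd_scale_direction: "dd n (\<lambda>i. r * c i) p = scale r (dd n c p)"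
  by (simp add: dd_def pm.scale_sum_right)

lemma lc_add: "lc n c (p + q) = lc n c p + lc n c q"
  by (simp add: lc_def lookup_add algebra_simps sum.distrib)

lemma lc_scale: "lc n c (scale r p) = r * lc n c p"
  by (simp only: lc_def sum_distrib_left lookup_scale mult.left_commute)

lemma linear_lc: "Vector_Spaces.linear scale (*) (lc n c)"
  by (rule Vector_Spaces.linear_iff[THEN iffD2]) (simp add: lc_add lc_scale pm.vector_space_axioms sc.vector_space_axioms)

lemma lc_add_direction: "lc n (\<lambda>i. c i + c' i) p = lc n c p + lc n c' p"
  by (simp add: lc_def algebra_simps sum.distrib)

lemma lc_scale_direction: "lc n (\<lambda>i. r * c i) p = r * lc n c p"
  by (simp only: lc_def sum_distrib_left mult.assoc)

section \<open>Forms and linear forms\<close>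

lemma forms_iff:
  "p \<in> forms n d \<longleftrightarrow> (\<forall>m\<in>Poly_Mapping.keys p. Poly_Mapping.keys m \<subseteq> {..n} \<and> mon_deg m = d)"
  by (auto simp: forms_def poly_ring_def)

lemma mon_deg_superset:
  assumes "finite A" "Poly_Mapping.keys m \<subseteq> A"
  shows "mon_deg m = (\<Sum>i\<in>A. Poly_Mapping.lookup m i)"
  unfolding mon_deg_def using assms by (intro sum.mono_neutral_left) (auto simp: in_keys_iff)

lemma mon_deg_add: "mon_deg (m + m') = mon_deg m + mon_deg m'"
proof -
  let ?A = "Poly_Mapping.keys m \<union> Poly_Mapping.keys m'"
  have "mon_deg (m + m') = (\<Sum>i\<in>?A. Poly_Mapping.lookup (m + m') i)"
    by (rule mon_deg_superset) (auto dest: subsetD[OF Poly_Mapping.keys_add])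
  also have "\<dots> = (\<Sum>i\<in>?A. Poly_Mapping.lookup m i) + (\<Sum>i\<in>?A. Poly_Mapping.lookup m' i)"
    by (simp add: lookup_add sum.distrib)
  also have "\<dots> = mon_deg m + mon_deg m'"
    using mon_deg_superset[of ?A m] mon_deg_superset[of ?A m'] by simp
  finally show ?thesis .
qed

lemma mon_deg_var [simp]: "mon_deg (Poly_Mapping.single i (Suc 0)) = Suc 0"
  by (simp add: mon_deg_def)

lemma mon_deg_eq_0_iff: "mon_deg m = 0 \<longleftrightarrow> m = 0"
  by (auto simp: mon_deg_def in_keys_iff intro!: poly_mapping_eqI)

lemma mon_deg_eq_1:
  assumes "mon_deg m = 1"
  obtains i where "m = var i"
proof -
  have "m \<noteq> 0" using assms mon_deg_eq_0_iff[of m] by auto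
  then obtain i where i: "Poly_Mapping.lookup m i \<noteq> 0"
    by (metis lookup_zero poly_mapping_eqI)
  have eq: "m = (m - var i) + var i"
    using i by (auto intro!: poly_mapping_eqI simp: lookup_add lookup_minus lookup_single when_def)
  have "mon_deg m = mon_deg (m - var i) + 1"
    by (subst eq) (simp add: mon_deg_add)
  then have "m - var i = 0" using assms mon_deg_eq_0_iff by simp
  then show ?thesis using eq that by (metis add_0)
qed

lemma subspace_forms: "pm.subspace (forms n d :: 'k::field mpoly set)"
proof (rule pm.subspaceI)
  fix p q :: "'k mpoly" assume "p \<in> forms n d" "q \<in> forms n d"
  then show "p + q \<in> forms n d"
    using Poly_Mapping.keys_add[of p q] unfolding forms_iff by blast
next
  fix c and p :: "'k mpoly" assume "p \<in> forms n d"
  then show "scale c p \<in> forms n d"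
    unfolding forms_iff by (auto simp: in_keys_iff)
qed (simp add: forms_iff)

lemma forms_mult: "p \<in> forms n d \<Longrightarrow> q \<in> forms n e \<Longrightarrow> p * q \<in> forms n (d + e)"
  unfolding forms_iff
proof (intro ballI conjI)
  fix m
  assume p: "\<forall>m\<in>Poly_Mapping.keys p. Poly_Mapping.keys m \<subseteq> {..n} \<and> mon_deg m = d"
    and q: "\<forall>m\<in>Poly_Mapping.keys q. Poly_Mapping.keys m \<subseteq> {..n} \<and> mon_deg m = e"
    and "m \<in> Poly_Mapping.keys (p * q)"
  then obtain a b where ab: "m = a + b" "a \<in> Poly_Mapping.keys p" "b \<in> Poly_Mapping.keys q"
    using keys_mult[of p q] by blast
  show "Poly_Mapping.keys m \<subseteq> {..n}"
    using Poly_Mapping.keys_add[of a b] p q ab by blast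
  show "mon_deg m = d + e" using ab p q by (simp add: mon_deg_add)
qed

lemma one_in_forms: "1 \<in> forms n 0"
  by (auto simp: forms_iff mon_deg_def simp flip: single_one split: if_splits)

lemma forms_power: "p \<in> forms n d \<Longrightarrow> p ^ e \<in> forms n (e * d)"
  by (induction e) (auto simp: one_in_forms forms_mult)

lemma forms_prod:
  "(\<And>i. i \<in> A \<Longrightarrow> f i \<in> forms n (d i)) \<Longrightarrow> (\<Prod>i\<in>A. f i) \<in> forms n (\<Sum>i\<in>A. d i)"
  by (induction A rule: infinite_finite_induct) (auto simp: one_in_forms forms_mult)

lemma tdeg_form:
  assumes "p \<in> forms n d" "p \<noteq> 0"
  shows "tdeg p = d"
proof -
  have "mon_deg ` Poly_Mapping.keys p = {d}"
    using assms by (auto simp: forms_iff image_iff ex_in_conv)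
  then show ?thesis by (simp add: tdeg_def)
qed

lemma partial_forms: "p \<in> forms n (Suc d) \<Longrightarrow> partial i p \<in> forms n d"
  unfolding forms_iff
proof (intro ballI conjI)
  fix m
  assume p: "\<forall>m\<in>Poly_Mapping.keys p. Poly_Mapping.keys m \<subseteq> {..n} \<and> mon_deg m = Suc d"
    and "m \<in> Poly_Mapping.keys (partial i p)"
  then have m: "m + var i \<in> Poly_Mapping.keys p"
    by (auto simp: in_keys_iff lookup_partial)
  then have "mon_deg (m + var i) = Suc d" using p by blast
  then show "mon_deg m = d" by (simp add: mon_deg_add)
  have "Poly_Mapping.keys m \<subseteq> Poly_Mapping.keys (m + var i)"
    by (auto simp: in_keys_iff lookup_add)
  then show "Poly_Mapping.keys m \<subseteq> {..n}" using p m by blast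
qed

lemma dd_forms: "p \<in> forms n (Suc d) \<Longrightarrow> dd n c p \<in> forms n d"
  unfolding dd_def
  by (intro pm.subspace_sum[OF subspace_forms] pm.subspace_scale[OF subspace_forms] partial_forms)

lemma lookup_forms_1:
  assumes "p \<in> forms n 1" "Poly_Mapping.lookup p m \<noteq> 0"
  obtains i where "i \<le> n" "m = var i"
proof -
  have m: "mon_deg m = 1" "Poly_Mapping.keys m \<subseteq> {..n}"
    using assms by (auto simp: forms_iff in_keys_iff)
  then obtain i where i: "m = var i" using mon_deg_eq_1 by blast
  then show ?thesis using m that by auto
qed

text \<open>A coefficient of the derivative at a nonconstant monomial would come from a monomial of
  degree at least 2. This links the polynomial \<open>dd\<close> with the scalar
  \<open>lc\<close>.\<close>

lemma dd_forms_1: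
  assumes "p \<in> forms n 1"
  shows "dd n c p = Poly_Mapping.single 0 (lc n c p)"
proof (rule poly_mapping_eqI)
  fix m
  show "Poly_Mapping.lookup (dd n c p) m = Poly_Mapping.lookup (Poly_Mapping.single 0 (lc n c p)) m"
  proof (cases "m = 0")
    case True
    then show ?thesis by (simp add: dd_def lc_def lookup_sum_pm lookup_partial)
  next
    case False
    then have "mon_deg (m + var i) \<noteq> 1" for i
      using mon_deg_eq_0_iff[of m] by (simp add: mon_deg_add)
    then have "Poly_Mapping.lookup p (m + var i) = 0" for i
      using assms by (metis forms_iff in_keys_iff)
    then show ?thesis
      using False by (simp add: dd_def lookup_sum_pm lookup_partial lookup_single)
  qed
qed

lemma dd_forms_1_mult: "p \<in> forms n 1 \<Longrightarrow> dd n c p * q = scale (lc n c p) q"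
  by (simp only: dd_forms_1 scale_eq_mult)

section \<open>The variables as a basis of the linear forms, and functionals on it\<close>

definition X :: "nat \<Rightarrow> 'k::field mpoly" where
  "X i = Poly_Mapping.single (var i) 1"

lemma X_forms: "i \<le> n \<Longrightarrow> X i \<in> forms n 1"
  by (auto simp: X_def forms_iff)

lemma lookup_X: "Poly_Mapping.lookup (X i) (var j) = (if i = j then 1 else 0)"
proof -
  have "var i = var j \<longleftrightarrow> i = j"
    by (metis lookup_single_eq lookup_single_not_eq zero_neq_one)
  then show ?thesis by (simp add: X_def lookup_single when_def)
qed

lemma forms_1_expand:
  fixes p :: "'k::field mpoly"
  assumes "p \<in> forms n 1"
  shows "p = (\<Sum>i\<le>n. scale (Poly_Mapping.lookup p (var i)) (X i))"
proof (rule poly_mapping_eqI)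
  fix m
  show "Poly_Mapping.lookup p m =
    Poly_Mapping.lookup (\<Sum>i\<le>n. scale (Poly_Mapping.lookup p (var i)) (X i)) m"
  proof (cases "\<exists>j\<le>n. m = var j")
    case True
    then obtain j where "j \<le> n" "m = var j" by blast
    then show ?thesis
      by (auto simp: lookup_sum_pm lookup_X if_distrib sum.delta simp del: One_nat_def cong: if_cong)
  next
    case False
    then have "Poly_Mapping.lookup p m = 0" using assms lookup_forms_1 by metis
    moreover have "Poly_Mapping.lookup (X i :: 'k mpoly) m = 0" if "i \<le> n" for i
      using False that by (auto simp: X_def lookup_single when_def)
    ultimately show ?thesis by (auto simp: lookup_sum_pm intro: sum.neutral)
  qed
qed

lemma forms_1_span: "(forms n 1 :: 'k::field mpoly set) = pm.span (X ` {..n})"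
proof
  show "(forms n 1 :: 'k mpoly set) \<subseteq> pm.span (X ` {..n})"
  proof
    fix p :: "'k mpoly" assume "p \<in> forms n 1"
    then show "p \<in> pm.span (X ` {..n})"
      by (subst forms_1_expand) (auto intro: pm.span_sum pm.span_scale pm.span_base)
  qed
  show "pm.span (X ` {..n}) \<subseteq> (forms n 1 :: 'k mpoly set)"
    by (rule pm.span_minimal[OF _ subspace_forms]) (auto simp: X_forms simp del: One_nat_def)
qed

lemma inj_X: "inj (X :: nat \<Rightarrow> 'k::field mpoly)"
  by (rule injI) (metis lookup_X zero_neq_one)

lemma independent_X: "pm.independent (X ` {..n} :: 'k::field mpoly set)"
proof (rule pm.independent_if_scalars_zero)
  fix f :: "'k mpoly \<Rightarrow> 'k" and x :: "'k mpoly"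
  assume "(\<Sum>x\<in>X ` {..n}. scale (f x) x) = 0" "x \<in> X ` {..n}"
  then obtain j where j: "j \<le> n" "x = X j" and s: "(\<Sum>i\<le>n. scale (f (X i)) (X i)) = 0"
    by (auto simp: sum.reindex[OF inj_on_subset[OF inj_X]] comp_def)
  from arg_cong[OF s, of "\<lambda>p. Poly_Mapping.lookup p (var j)"] show "f x = 0"
    using j by (simp add: lookup_sum_pm lookup_X if_distrib sum.delta cong: if_cong del: One_nat_def)
qed simp

lemma forms_1_independent_card:
  assumes "pm.independent B" "B \<subseteq> forms n 1"
  shows "finite B \<and> card B \<le> Suc n"
  using pm.independent_span_bound[of "X ` {..n}" B] assms
  by (auto simp: forms_1_span card_image[OF inj_on_subset[OF inj_X]] simp del: One_nat_def)

lemma forms_1_basis_card: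
  assumes "pm.independent B" "B \<subseteq> forms n 1" "forms n 1 \<subseteq> pm.span B"
  shows "card B = Suc n"
proof -
  have "X ` {..n} \<subseteq> pm.span B" using assms(3) X_forms by blast
  then have "Suc n \<le> card B"
    using pm.independent_span_bound[of B "X ` {..n}"] forms_1_independent_card[OF assms(1,2)]
      independent_X by (auto simp: card_image[OF inj_on_subset[OF inj_X]])
  then show ?thesis using forms_1_independent_card[OF assms(1,2)] by simp
qed

text \<open>Every linear functional on the linear forms is \<open>lc n c\<close> for some direction
  \<open>c\<close>, namely the one whose coefficients are its values on the variables.\<close>

lemma lc_interpolate:
  fixes B :: "'k::field mpoly set"
  assumes "pm.independent B" "B \<subseteq> forms n 1"
  obtains c where "\<And>b. b \<in> B \<Longrightarrow> lc n c b = f b"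
proof -
  obtain g where g: "Vector_Spaces.linear scale (*) g" "\<forall>b\<in>B. g b = f b"
    using ps.linear_independent_extend[OF assms(1)] by blast
  have "lc n (\<lambda>i. g (X i)) b = f b" if "b \<in> B" for b
  proof -
    have "b \<in> forms n 1" using that assms by blast
    then have "g b = g (\<Sum>i\<le>n. scale (Poly_Mapping.lookup b (var i)) (X i))"
      using forms_1_expand[of b n] by simp
    also have "\<dots> = lc n (\<lambda>i. g (X i)) b"
      by (simp add: ps.linear_sum[OF g(1)] ps.linear_scale[OF g(1)] lc_def mult.commute)
    finally show ?thesis using g(2) that by simp
  qed
  then show ?thesis using that by blast
qed

text \<open>A basis of the span of \<open>S\<close> stays independent when \<open>p\<close> is
  added, so the values 1 at \<open>p\<close> and 0 on that basis can be prescribed.\<close>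

lemma separating_functional:
  fixes S :: "'k::field mpoly set"
  assumes "S \<subseteq> forms n 1" "p \<in> forms n 1" "p \<notin> pm.span S"
  obtains c where "lc n c p = 1" "\<And>b. b \<in> S \<Longrightarrow> lc n c b = 0"
proof -
  obtain B where B: "B \<subseteq> S" "pm.independent B" "S \<subseteq> pm.span B"
    using pm.maximal_independent_subset[of S] by blast
  have "pm.span B = pm.span S"
    using B by (meson pm.span_mono pm.span_minimal pm.subspace_span subset_antisym)
  then have "pm.independent (insert p B)" "p \<notin> B"
    using assms(3) B(2) pm.independent_insertI pm.span_base by metis+
  then obtain c where c: "\<And>b. b \<in> insert p B \<Longrightarrow> lc n c b = (if b = p then 1 else 0)"
    using lc_interpolate[of "insert p B" n "\<lambda>b. if b = p then 1 else 0"] assms B(1) by blast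
  have "lc n c b = 0" if "b \<in> B" for b using c[of b] that \<open>p \<notin> B\<close> by auto
  then have "lc n c b = 0" if "b \<in> S" for b
    using ps.linear_eq_0_on_span[OF linear_lc, of B n c b] B(3) that by blast
  moreover have "lc n c p = 1" using c[of p] by simp
  ultimately show ?thesis using that by blast
qed

section \<open>Dimension counting\<close>

text \<open>Avoids the value 0 of \<open>pm.dim\<close> on infinite-dimensional sets; \<open>D\<close> need not be a subspace.\<close>

definition dim_ge :: "('a \<Rightarrow>\<^sub>0 'k::field) set \<Rightarrow> nat \<Rightarrow> bool" where
  "dim_ge D m \<longleftrightarrow> (\<exists>B. finite B \<and> B \<subseteq> D \<and> pm.independent B \<and> m \<le> card B)"

lemma dim_ge_0 [simp]: "dim_ge D 0"
  unfolding dim_ge_def by (rule exI[of _ "{}"]) (simp add: pm.independent_empty)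

lemma dim_ge_mono: "dim_ge D m \<Longrightarrow> D \<subseteq> E \<Longrightarrow> k \<le> m \<Longrightarrow> dim_ge E k"
  unfolding dim_ge_def by (meson order.trans)

lemma dim_ge_card: "dim_ge D m \<Longrightarrow> D \<subseteq> pm.span S \<Longrightarrow> finite S \<Longrightarrow> m \<le> card S"
  unfolding dim_ge_def using pm.independent_span_bound by (meson order.trans)

text \<open>Preimages in \<open>D\<close> of independent elements of the image are independent of
  the kernel part: \<open>T\<close> kills the kernel part of a relation, so the coefficients of the
  preimages vanish first.\<close>

lemma dim_ge_rank_nullity:
  fixes T :: "('a \<Rightarrow>\<^sub>0 'k::field) \<Rightarrow> ('b \<Rightarrow>\<^sub>0 'k)"
  assumes T: "Vector_Spaces.linear scale scale T"
    and image: "dim_ge (T ` D) a" and kernel: "dim_ge {x \<in> D. T x = 0} b"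
  shows "dim_ge D (a + b)"
proof -
  obtain B0 where B0: "finite B0" "B0 \<subseteq> T ` D" "pm.independent B0" "a \<le> card B0"
    using image unfolding dim_ge_def by (elim exE conjE)
  obtain B1 where B1: "finite B1" "B1 \<subseteq> {x \<in> D. T x = 0}" "pm.independent B1" "b \<le> card B1"
    using kernel unfolding dim_ge_def by (elim exE conjE)
  have "\<forall>y\<in>B0. \<exists>x\<in>D. T x = y" using B0(2) by blast
  then obtain g where g: "\<And>y. y \<in> B0 \<Longrightarrow> g y \<in> D" "\<And>y. y \<in> B0 \<Longrightarrow> T (g y) = y" by metis
  have inj: "inj_on g B0" by (metis g(2) inj_onI)
  have "0 \<notin> B0" using B0(3) pm.dependent_zero by blast
  then have disj: "g ` B0 \<inter> B1 = {}" using B1(2) g(2) by fastforce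
  have "pm.independent (g ` B0 \<union> B1)"
  proof (rule pm.independent_if_scalars_zero)
    fix f x
    assume s: "(\<Sum>x\<in>g ` B0 \<union> B1. scale (f x) x) = 0" and x: "x \<in> g ` B0 \<union> B1"
    have s': "(\<Sum>y\<in>B0. scale (f (g y)) (g y)) + (\<Sum>x\<in>B1. scale (f x) x) = 0"
      using s B0(1) B1(1) disj by (simp add: sum.union_disjoint sum.reindex[OF inj] comp_def)
    have "T (\<Sum>x\<in>B1. scale (f x) x) = 0"
      using B1(2) by (auto simp: pp.linear_sum[OF T] pp.linear_scale[OF T] intro!: sum.neutral)
    then have "(\<Sum>y\<in>B0. scale (f (g y)) y) = 0"
      using arg_cong[OF s', of T] g(2)
      by (simp add: pp.linear_add[OF T] pp.linear_sum[OF T] pp.linear_scale[OF T] pp.linear_0[OF T])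
    then have z: "f (g y) = 0" if "y \<in> B0" for y
      using pm.independentD[OF B0(3,1) order.refl, of "\<lambda>y. f (g y)"] that by blast
    then have "(\<Sum>x\<in>B1. scale (f x) x) = 0" using s' by simp
    then have "f x = 0" if "x \<in> B1" for x
      using pm.independentD[OF B1(3,1) order.refl, of f] that by blast
    then show "f x = 0" using x z by blast
  qed (use B0 B1 in auto)
  moreover have "a + b \<le> card (g ` B0 \<union> B1)"
    using B0 B1 disj by (simp add: card_Un_disjoint card_image[OF inj])
  ultimately show ?thesis unfolding dim_ge_def
    using B0(1) B1(1,2) g(1) by (intro exI[of _ "g ` B0 \<union> B1"]) auto
qed

text \<open>Subtracting multiples of one vector \<open>b0\<close> with \<open>f b0\<close> nonzero
  moves the other vectors into the kernel, so at most one dimension is lost.\<close>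

lemma dim_ge_kernel:
  fixes W :: "('a \<Rightarrow>\<^sub>0 'k::field) set"
  assumes f: "Vector_Spaces.linear scale (*) f" and W: "pm.subspace W" and dim: "dim_ge W m"
  shows "dim_ge {w \<in> W. f w = 0} (m - 1)"
proof -
  obtain B where B: "finite B" "B \<subseteq> W" "pm.independent B" "m \<le> card B"
    using dim unfolding dim_ge_def by (elim exE conjE)
  show ?thesis
  proof (cases "\<forall>b\<in>B. f b = 0")
    case True
    then show ?thesis unfolding dim_ge_def using B by (intro exI[of _ B]) auto
  next
    case False
    then obtain b0 where b0: "b0 \<in> B" "f b0 \<noteq> 0" by blast
    let ?h = "\<lambda>b. b - scale (f b / f b0) b0"
    let ?S = "?h ` (B - {b0})"
    have S: "?S \<subseteq> {w \<in> W. f w = 0}"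
      using B(2) b0 by (auto simp: ps.linear_diff[OF f] ps.linear_scale[OF f]
          intro!: pm.subspace_diff[OF W] pm.subspace_scale[OF W])
    \<comment> \<open>It suffices that \<open>C\<close> and \<open>b0\<close> together span
      \<open>B\<close>; the exchange bound then gives the cardinality without a separate proof that
      \<open>?S\<close> is independent.\<close>
    obtain C where C: "C \<subseteq> ?S" "pm.independent C" "?S \<subseteq> pm.span C"
      using pm.maximal_independent_subset[of ?S] by blast
    have fin: "finite C" using C(1) B(1) by (meson finite_Diff finite_imageI finite_subset)
    have "b \<in> pm.span (insert b0 C)" if "b \<in> B" for b
    proof (cases "b = b0")
      case False
      then have "?h b \<in> pm.span C" using C(3) that by blast
      then have "?h b \<in> pm.span (insert b0 C)" using pm.span_mono[of C "insert b0 C"] by blast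
      moreover have "scale (f b / f b0) b0 \<in> pm.span (insert b0 C)"
        by (intro pm.span_scale pm.span_base) simp
      ultimately show ?thesis using pm.span_add by fastforce
    qed (simp add: pm.span_base)
    then have "card B \<le> card (insert b0 C)"
      using pm.independent_span_bound[of "insert b0 C" B] B fin by blast
    then have "m - 1 \<le> card C" using B(4) fin by (auto simp: card_insert_if split: if_splits)
    moreover have "C \<subseteq> {w \<in> W. f w = 0}" using C(1) S by (rule subset_trans)
    ultimately show ?thesis unfolding dim_ge_def using C(2) fin by (intro exI[of _ C]) simp
  qed
qed

text \<open>Finitely many proper subspaces do not cover a vector space over an infinite field. In
  the induction each form vanishes at most once on the line \<open>c + r * c'\<close>.\<close>

lemma generic_direction:
  fixes P :: "'k::field_char_0 mpoly set" and V :: "(nat \<Rightarrow> 'k) set"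
  assumes fin: "finite P" and V0: "(\<lambda>_. 0) \<in> V"
    and V_lin: "\<And>c c' r. c \<in> V \<Longrightarrow> c' \<in> V \<Longrightarrow> (\<lambda>i. c i + r * c' i) \<in> V"
    and P: "\<And>p. p \<in> P \<Longrightarrow> \<exists>c\<in>V. lc n c p \<noteq> 0"
  shows "\<exists>c\<in>V. \<forall>p\<in>P. lc n c p \<noteq> 0"
  using fin P
proof (induction P rule: finite_induct)
  case empty
  then show ?case using V0 by blast
next
  case (insert p P)
  then obtain c where c: "c \<in> V" "\<forall>p\<in>P. lc n c p \<noteq> 0" by blast
  obtain c' where c': "c' \<in> V" "lc n c' p \<noteq> 0" using insert.prems by blast
  \<comment> \<open>The values of \<open>r\<close> at which some form can vanish. If
    \<open>lc n c' x\<close> is 0, the quotient is 0 by convention, and \<open>x\<close> then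
    vanishes for no \<open>r\<close>.\<close>
  let ?bad = "(\<lambda>x. - lc n c x / lc n c' x) ` insert p P"
  obtain r where r: "r \<notin> insert 0 ?bad"
    using ex_new_if_finite[OF infinite_UNIV_char_0, of "insert 0 ?bad"] insert.hyps(1) by blast
  have "\<forall>x\<in>insert p P. lc n (\<lambda>i. c i + r * c' i) x \<noteq> 0"
  proof
    fix x assume that: "x \<in> insert p P"
    show "lc n (\<lambda>i. c i + r * c' i) x \<noteq> 0"
    proof
      assume "lc n (\<lambda>i. c i + r * c' i) x = 0"
      then have eq: "lc n c x + r * lc n c' x = 0"
        by (simp add: lc_add_direction lc_scale_direction)
      show False
      proof (cases "lc n c' x = 0")
        case True
        then show False using eq c c' that by auto
      next
        case False
        then have "r = - lc n c x / lc n c' x"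
          using eq by (simp add: field_simps eq_neg_iff_add_eq_0)
        then show False using r that by blast
      qed
    qed
  qed
  then show ?case using V_lin[OF c(1) c'(1), of r] by (rule bexI)
qed

lemma lc_nonzero_direction: "lc n c p \<noteq> 0 \<Longrightarrow> \<exists>i\<le>n. c i \<noteq> 0"
  unfolding lc_def by (metis (mono_tags, lifting) atMost_iff mult_eq_0_iff sum.neutral)

lemma dd_sum_direction: "dd n (\<lambda>i. \<Sum>x\<in>A. f x * h x i) p = (\<Sum>x\<in>A. scale (f x) (dd n (h x) p))"
proof -
  have "dd n (\<lambda>i. \<Sum>x\<in>A. f x * h x i) p = (\<Sum>i\<le>n. \<Sum>x\<in>A. scale (f x * h x i) (partial i p))"
    unfolding dd_def by (simp add: pm.scale_sum_left)
  also have "\<dots> = (\<Sum>x\<in>A. \<Sum>i\<le>n. scale (f x * h x i) (partial i p))" by (rule sum.swap)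
  finally show ?thesis by (simp add: dd_def pm.scale_sum_right)
qed

lemma lc_sum_direction: "lc n (\<lambda>i. \<Sum>x\<in>A. f x * h x i) p = (\<Sum>x\<in>A. f x * lc n (h x) p)"
proof -
  have "lc n (\<lambda>i. \<Sum>x\<in>A. f x * h x i) p = (\<Sum>i\<le>n. \<Sum>x\<in>A. f x * h x i * Poly_Mapping.lookup p (var i))"
    unfolding lc_def by (simp add: sum_distrib_right)
  also have "\<dots> = (\<Sum>x\<in>A. \<Sum>i\<le>n. f x * h x i * Poly_Mapping.lookup p (var i))" by (rule sum.swap)
  finally show ?thesis by (simp only: lc_def sum_distrib_left mult.assoc)
qed

section \<open>One linear factor\<close>

lemma dd_power_form:
  assumes "p \<in> forms n 1"
  shows "dd n c (p ^ Suc e) = scale (of_nat (Suc e) * lc n c p) (p ^ e)"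
proof -
  have "p ^ e * dd n c p = scale (lc n c p) (p ^ e)"
    using assms by (simp only: mult.commute[of "p ^ e"] dd_forms_1_mult)
  then show ?thesis by (simp only: dd_power diff_Suc_1 pm.scale_scale)
qed

text \<open>The derivative of a power of \<open>m i\<close> is a multiple of the next lower power,
  with factor 0 if the direction kills \<open>m i\<close>. Differentiation thus removes the points
  on a hyperplane.\<close>

lemma dd_power_span:
  fixes m :: "nat \<Rightarrow> 'k::field mpoly"
  assumes m: "\<And>i. i \<in> I \<Longrightarrow> m i \<in> forms n 1"
    and G: "G \<in> pm.span ((\<lambda>i. m i ^ Suc e) ` I)"
  shows "dd n c G \<in> pm.span ((\<lambda>i. m i ^ e) ` {i \<in> I. lc n c (m i) \<noteq> 0})" (is "_ \<in> ?R")
proof -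
  have "dd n c (m i ^ Suc e) \<in> ?R" if "i \<in> I" for i
  proof (cases "lc n c (m i) = 0")
    case True
    then have "dd n c (m i ^ Suc e) = 0" by (simp only: dd_power_form[OF m[OF that]]) simp
    then show ?thesis by (simp add: pm.span_zero)
  next
    case False
    then have "m i ^ e \<in> ?R" using that by (intro pm.span_base) blast
    then show ?thesis by (simp only: dd_power_form[OF m[OF that]] pm.span_scale)
  qed
  then have "dd n c ` (\<lambda>i. m i ^ Suc e) ` I \<subseteq> ?R" by blast
  then have "pm.span (dd n c ` (\<lambda>i. m i ^ Suc e) ` I) \<subseteq> ?R" by (rule pm.span_minimal) simp
  then show ?thesis using G unfolding pp.linear_span_image[OF linear_dd] by blast
qed

text \<open>If \<open>l\<close> and the points did not span all linear forms, a direction killing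
  them all would kill \<open>G\<close> as well. Hence \<open>l\<close> extends by \<open>n\<close>
  of the points to a basis, and the direction dual to \<open>l\<close> removes these points.\<close>

lemma removing_direction:
  fixes l :: "'k::field mpoly" and m :: "nat \<Rightarrow> 'k mpoly"
  assumes l: "l \<in> forms n 1" "l \<noteq> 0" and fin: "finite I"
    and m: "\<And>i. i \<in> I \<Longrightarrow> m i \<in> forms n 1"
    and G: "G \<in> pm.span ((\<lambda>i. m i ^ Suc e) ` I)"
    and nonzero: "\<And>c. lc n c l = 0 \<Longrightarrow> \<exists>i\<le>n. c i \<noteq> 0 \<Longrightarrow> dd n c G \<noteq> 0"
  obtains c where "lc n c l = 1" "card {i \<in> I. lc n c (m i) \<noteq> 0} + n \<le> card I"
proof -
  let ?S = "insert l (m ` I)"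
  have S: "?S \<subseteq> forms n 1" using l m by blast
  have span: "forms n 1 \<subseteq> pm.span ?S"
  proof
    fix p :: "'k mpoly" assume p: "p \<in> forms n 1"
    show "p \<in> pm.span ?S"
    proof (rule ccontr)
      assume "p \<notin> pm.span ?S"
      then obtain c where c: "lc n c p = 1" "\<And>b. b \<in> ?S \<Longrightarrow> lc n c b = 0"
        using separating_functional[OF S p] by blast
      have "dd n c G \<in> pm.span ((\<lambda>i. m i ^ e) ` {i \<in> I. lc n c (m i) \<noteq> 0})"
        using m G by (rule dd_power_span)
      also have "{i \<in> I. lc n c (m i) \<noteq> 0} = {}" using c(2) by blast
      finally have "dd n c G = 0" by simp
      moreover have "\<exists>i\<le>n. c i \<noteq> 0" using c(1) by (intro lc_nonzero_direction[of n c p]) simp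
      ultimately show False using nonzero[of c] c(2) by blast
    qed
  qed
  obtain B where B: "{l} \<subseteq> B" "B \<subseteq> ?S" "pm.independent B" "?S \<subseteq> pm.span B"
    using pm.maximal_independent_subset_extend[of "{l}" ?S] l(2) by (auto simp: pm.dependent_single)
  have "forms n 1 \<subseteq> pm.span B"
    using span pm.span_minimal[OF B(4)] by auto
  moreover have B_forms: "B \<subseteq> forms n 1" using B(2) S by (rule subset_trans)
  ultimately have card_B: "card B = Suc n" "finite B"
    using forms_1_basis_card[OF B(3)] forms_1_independent_card[OF B(3)] by blast+
  obtain c where c: "\<And>b. b \<in> B \<Longrightarrow> lc n c b = (if b = l then 1 else 0)"
    using lc_interpolate[OF B(3) B_forms, of "\<lambda>b. if b = l then 1 else 0"] by blast
  \<comment> \<open>Several indices may carry the same point, so \<open>?J\<close> has at least, not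
    exactly, \<open>n\<close> elements.\<close>
  let ?J = "{i \<in> I. m i \<in> B - {l}}"
  have "B - {l} \<subseteq> m ` ?J" using B(2) by blast
  then have "card (B - {l}) \<le> card (m ` ?J)"
    by (rule card_mono[rotated]) (simp add: fin)
  also have "\<dots> \<le> card ?J" by (rule card_image_le) (simp add: fin)
  finally have "card (B - {l}) \<le> card ?J" .
  then have "n \<le> card ?J" using card_B B(1) by simp
  moreover have "{i \<in> I. lc n c (m i) \<noteq> 0} \<inter> ?J = {}" using c by auto
  then have "card {i \<in> I. lc n c (m i) \<noteq> 0} + card ?J = card ({i \<in> I. lc n c (m i) \<noteq> 0} \<union> ?J)"
    using fin by (simp add: card_Un_disjoint)
  moreover have "\<dots> \<le> card I" using fin by (intro card_mono) auto
  ultimately have "card {i \<in> I. lc n c (m i) \<noteq> 0} + n \<le> card I" by linarith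
  then show ?thesis using that c[of l] B(1) by auto
qed

text \<open>The product rule yields the cofactor \<open>(b + 1) p + lc(p) l\<close>. Were it 0,
  evaluation along \<open>c\<close> would give \<open>(b + 2) lc(p) = 0\<close>, hence
  \<open>lc(p) = 0\<close> and \<open>p = 0\<close> in characteristic 0.\<close>

lemma dd_linear_power_mult:
  fixes l :: "'k::field_char_0 mpoly"
  assumes l: "l \<in> forms n 1" "lc n c l = 1" and p: "p \<in> forms n 1" "p \<noteq> 0"
  obtains p' where "p' \<in> forms n 1" "p' \<noteq> 0" "dd n c (l ^ Suc b * p) = l ^ b * p'"
proof
  let ?p' = "scale (of_nat (Suc b)) p + scale (lc n c p) l"
  show "?p' \<in> forms n 1"
    by (intro pm.subspace_add[OF subspace_forms] pm.subspace_scale[OF subspace_forms] p l)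
  have "dd n c p * l ^ Suc b = scale (lc n c p) (l ^ Suc b)" using p(1) by (rule dd_forms_1_mult)
  moreover have "dd n c (l ^ Suc b) = scale (of_nat (Suc b)) (l ^ b)"
    using dd_power_form[OF l(1), of c b] unfolding l(2) mult_1_right .
  ultimately have "dd n c (l ^ Suc b * p) = scale (of_nat (Suc b)) (l ^ b * p) + scale (lc n c p) (l ^ b * l)"
    by (simp only: dd_mult mult.commute[of "l ^ b * l" "dd n c p"] scale_mult_left power_Suc2)
  then show "dd n c (l ^ Suc b * p) = l ^ b * ?p'"
    by (simp only: distrib_left scale_mult_right)
  show "?p' \<noteq> 0"
  proof
    assume zero: "?p' = 0"
    have "lc n c ?p' = of_nat (Suc b) * lc n c p + lc n c p"
      using l(2) by (simp add: lc_add lc_scale)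
    moreover have "lc n c ?p' = 0" unfolding zero by (simp add: lc_def)
    ultimately have "of_nat (Suc (Suc b)) * lc n c p = 0"
      by (simp add: algebra_simps)
    then have "lc n c p = 0" by (simp only: mult_eq_0_iff of_nat_eq_0_iff) simp
    then have "scale (of_nat (Suc b)) p = 0" using zero by simp
    then show False using p(2) by (simp only: pm.scale_eq_0_iff of_nat_eq_0_iff) simp
  qed
qed

lemma one_linear_factor_bound:
  fixes l q :: "'k::field_char_0 mpoly" and m :: "nat \<Rightarrow> 'k mpoly"
  assumes l: "l \<in> forms n 1" "l \<noteq> 0" and q: "q \<in> forms n 2"
    and nonzero: "\<And>c. lc n c l = 0 \<Longrightarrow> \<exists>i\<le>n. c i \<noteq> 0 \<Longrightarrow> dd n c q \<noteq> 0"
    and m: "\<And>i. i < r \<Longrightarrow> m i \<in> forms n 1"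
    and F: "l ^ a * q \<in> pm.span ((\<lambda>i. m i ^ (a + 2)) ` {..<r})"
  shows "(a + 1) * n \<le> r"
proof -
  \<comment> \<open>\<open>G\<close> is a \<open>j\<close>-fold derivative and \<open>I\<close>
    indexes the remaining points. The last conjunct ensures that no nonzero direction killing
    \<open>l\<close> kills \<open>G\<close>, so that points can be removed again.\<close>
  have inv: "\<exists>I G. I \<subseteq> {..<r} \<and> card I + j * n \<le> r \<and>
      G \<in> pm.span ((\<lambda>i. m i ^ (a + 2 - j)) ` I) \<and>
      (\<forall>c. lc n c l = 0 \<longrightarrow> (\<exists>i\<le>n. c i \<noteq> 0) \<longrightarrow>
        (\<exists>p\<in>forms n 1. p \<noteq> 0 \<and> dd n c G = l ^ (a - j) * p))" if "j \<le> a" for j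
    using that
  proof (induction j)
    case 0
    have "\<exists>p\<in>forms n 1. p \<noteq> 0 \<and> dd n c (l ^ a * q) = l ^ a * p"
      if c: "lc n c l = 0" "\<exists>i\<le>n. c i \<noteq> 0" for c
    proof (intro bexI conjI)
      have "dd n c l = 0" using c(1) l(1) by (simp add: dd_forms_1)
      then show "dd n c (l ^ a * q) = l ^ a * dd n c q" by (simp add: dd_mult dd_power)
      show "dd n c q \<noteq> 0" using nonzero c .
      show "dd n c q \<in> forms n 1" using q by (intro dd_forms) (simp add: numeral_2_eq_2)
    qed
    then show ?case using F by (intro exI[of _ "{..<r}"] exI[of _ "l ^ a * q"]) auto
  next
    case (Suc j)
    then obtain I G where I: "I \<subseteq> {..<r}" "card I + j * n \<le> r"
      and G: "G \<in> pm.span ((\<lambda>i. m i ^ (a + 2 - j)) ` I)"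
      and G': "\<And>c. lc n c l = 0 \<Longrightarrow> \<exists>i\<le>n. c i \<noteq> 0 \<Longrightarrow>
        \<exists>p\<in>forms n 1. p \<noteq> 0 \<and> dd n c G = l ^ (a - j) * p"
      by (metis Suc_leD)
    have e: "a + 2 - j = Suc (a + 2 - Suc j)" "a - j = Suc (a - Suc j)" using Suc.prems by auto
    have mI: "m i \<in> forms n 1" if "i \<in> I" for i using m I(1) that by blast
    have fin: "finite I" using I(1) finite_subset by blast
    have "dd n c G \<noteq> 0" if "lc n c l = 0" "\<exists>i\<le>n. c i \<noteq> 0" for c
      using G'[OF that] l(2) by auto
    then obtain h where h: "lc n h l = 1" "card {i \<in> I. lc n h (m i) \<noteq> 0} + n \<le> card I"
      using removing_direction[OF l fin mI G[unfolded e]] by blast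
    let ?I = "{i \<in> I. lc n h (m i) \<noteq> 0}"
    have "dd n h G \<in> pm.span ((\<lambda>i. m i ^ (a + 2 - Suc j)) ` ?I)"
      using mI G unfolding e by (rule dd_power_span)
    moreover have "\<exists>p\<in>forms n 1. p \<noteq> 0 \<and> dd n c (dd n h G) = l ^ (a - Suc j) * p"
      if c: "lc n c l = 0" "\<exists>i\<le>n. c i \<noteq> 0" for c
    proof -
      obtain p where p: "p \<in> forms n 1" "p \<noteq> 0" "dd n c G = l ^ Suc (a - Suc j) * p"
        using G'[OF c] unfolding e by blast
      \<comment> \<open>As derivatives commute, \<open>h\<close> may act on the known product: the
        exponent of \<open>l\<close> drops by one and the cofactor stays a nonzero linear
        form.\<close>
      have "dd n c (dd n h G) = dd n h (l ^ Suc (a - Suc j) * p)"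
        by (simp only: dd_commute[of n c h] p(3))
      then show ?thesis using dd_linear_power_mult[OF l(1) h(1) p(1,2)] by metis
    qed
    moreover have "?I \<subseteq> {..<r}" "card ?I + Suc j * n \<le> r" using I h(2) by auto
    ultimately show ?case by (intro exI[of _ ?I] exI[of _ "dd n h G"]) blast
  qed
  \<comment> \<open>After \<open>a\<close> removals a form of degree 2 is left, which allows one
    more; this gives the factor \<open>a + 1\<close>.\<close>
  obtain I G where I: "I \<subseteq> {..<r}" "card I + a * n \<le> r"
    and G: "G \<in> pm.span ((\<lambda>i. m i ^ Suc 1) ` I)"
    and G': "\<And>c. lc n c l = 0 \<Longrightarrow> \<exists>i\<le>n. c i \<noteq> 0 \<Longrightarrow> dd n c G \<noteq> 0"
    using inv[of a] by (auto simp: numeral_2_eq_2)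
  have mI: "m i \<in> forms n 1" if "i \<in> I" for i using m I(1) that by blast
  have fin: "finite I" using I(1) finite_subset by blast
  obtain h where "card {i \<in> I. lc n h (m i) \<noteq> 0} + n \<le> card I"
    using removing_direction[OF l fin mI G G'] by blast
  then show ?thesis using I(2) by simp
qed

section \<open>Several linear factors\<close>

text \<open>The case of positive dimension in linear terms. Since 0 lies in every span,
  \<open>nondegenerate\<close> contains both condition (b) and the fact that \<open>dd n c q\<close>
  is nonzero.\<close>

locale power_sum_setup =
  fixes n k r :: nat and l :: "nat \<Rightarrow> 'k::field_char_0 mpoly" and a :: "nat \<Rightarrow> nat"
    and q :: "'k mpoly" and m :: "nat \<Rightarrow> 'k mpoly"
  assumes l_form: "i \<le> k \<Longrightarrow> l i \<in> forms n 1"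
    and l_inj: "inj_on l {..k}" and l_indep: "pm.independent (l ` {..k})"
    and a_pos: "i \<le> k \<Longrightarrow> 0 < a i" and k_pos: "0 < k" and k_less: "k < n"
    and q_form: "q \<in> forms n 2"
    and m_form: "i < r \<Longrightarrow> m i \<in> forms n 1"
    and nondegenerate: "(\<And>i. i \<le> k \<Longrightarrow> lc n c (l i) = 0) \<Longrightarrow> \<exists>i\<le>n. c i \<noteq> 0 \<Longrightarrow>
      dd n c q \<notin> pm.span (l ` {..k})"
    and power_sum: "(\<Prod>i\<le>k. l i ^ a i) * q \<in> pm.span ((\<lambda>i. m i ^ ((\<Sum>i\<le>k. a i) + 2)) ` {..<r})"
begin

text \<open>The linear forms of \<open>S\<close> vanishing on the span of the points, as coefficient
  vectors; entries beyond index \<open>n\<close> are arbitrary.\<close>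

definition V where "V = {c. \<forall>i\<le>k. lc n c (l i) = 0}"

definition W where "W = (\<lambda>c. dd n c q) ` V"

definition N where "N = (\<Sum>i\<le>k. a i)"

definition \<mu> where "\<mu> b = (\<Prod>i\<le>k. l i ^ b i)"

text \<open>The indices of the points outside the span of the \<open>l i\<close>.\<close>

definition I where "I = {i. i < r \<and> (\<exists>c\<in>V. lc n c (m i) \<noteq> 0)}"

definition D where "D e = pm.span ((\<lambda>i. m i ^ e) ` I)"

text \<open>Up to scalars these are the divisors of \<open>\<mu> a\<close> of degree
  \<open>e\<close>.\<close>

definition C where "C e = \<mu> ` {b. (\<forall>i\<le>k. b i \<le> a i) \<and> (\<Sum>i\<le>k. b i) = e}"

lemma V_closed: "c \<in> V \<Longrightarrow> c' \<in> V \<Longrightarrow> (\<lambda>i. c i + x * c' i) \<in> V"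
  by (simp add: V_def lc_add_direction lc_scale_direction)

lemma zero_in_V: "(\<lambda>_. 0) \<in> V"
  by (simp add: V_def lc_def)

lemma finite_I: "finite I"
  by (simp add: I_def)

lemma m_form_I: "i \<in> I \<Longrightarrow> m i \<in> forms n 1"
  using m_form by (simp add: I_def del: One_nat_def)

lemma subspace_W: "pm.subspace W"
proof (rule pm.subspaceI)
  show "0 \<in> W" using zero_in_V by (force simp: W_def dd_def)
next
  fix x y assume "x \<in> W" "y \<in> W"
  then obtain c c' where c: "c \<in> V" "c' \<in> V" "x = dd n c q" "y = dd n c' q"
    by (auto simp: W_def)
  have "x + y = dd n (\<lambda>i. c i + 1 * c' i) q" by (simp only: c mult_1_left dd_add_direction)
  then show "x + y \<in> W" unfolding W_def using V_closed[OF c(1,2)] by (rule image_eqI)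
next
  fix s x assume "x \<in> W"
  then obtain c where c: "c \<in> V" "x = dd n c q" by (auto simp: W_def)
  have "scale s x = dd n (\<lambda>i. s * c i) q" by (simp only: c dd_scale_direction)
  moreover have "(\<lambda>i. s * c i) \<in> V" using V_closed[OF zero_in_V c(1), of s] by simp
  ultimately show "scale s x \<in> W" unfolding W_def by (rule image_eqI)
qed

lemma W_forms: "W \<subseteq> forms n 1"
  unfolding W_def using q_form by (auto intro!: dd_forms simp: numeral_2_eq_2)

text \<open>By nondegeneracy the direction behind \<open>w\<close> vanishes in all coordinates up to
  \<open>n\<close>. So \<open>W\<close> and the span of the \<open>l i\<close> form a direct
  sum.\<close>

lemma W_span_l:
  assumes "w \<in> W" "w \<in> pm.span (l ` {..k})"
  shows "w = 0"
proof -
  obtain c where c: "c \<in> V" "w = dd n c q" using assms(1) by (auto simp: W_def)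
  then have "\<not> (\<exists>i\<le>n. c i \<noteq> 0)"
    using nondegenerate[of c] assms(2) by (auto simp: V_def)
  then show ?thesis by (simp add: c dd_def)
qed

text \<open>Completing the \<open>l i\<close> to a basis of the linear forms adds
  \<open>n - k\<close> elements. Their dual directions lie in \<open>V\<close>, and nondegeneracy
  keeps the derivatives of \<open>q\<close> along them independent.\<close>

lemma dim_W: "dim_ge W (n - k)"
proof -
  have L: "l ` {..k} \<subseteq> forms n 1" using l_form by blast
  obtain B where B: "l ` {..k} \<subseteq> B" "B \<subseteq> forms n 1" "pm.independent B" "forms n 1 \<subseteq> pm.span B"
    using pm.maximal_independent_subset_extend[OF L l_indep] by blast
  define E where "E = B - l ` {..k}"
  have finB: "finite B" using forms_1_independent_card[OF B(3,2)] by blast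
  then have finE: "finite E" by (simp add: E_def)
  have "card (l ` {..k}) = Suc k" by (simp add: card_image l_inj)
  then have card_E: "card E = n - k"
    using forms_1_basis_card[OF B(3,2,4)] B(1) finB by (simp add: E_def card_Diff_subset)
  have "\<forall>e. \<exists>c. \<forall>b\<in>B. lc n c b = (if b = e then 1 else 0)"
  proof
    fix e
    obtain c where "\<And>b. b \<in> B \<Longrightarrow> lc n c b = (if b = e then 1 else 0)"
      using lc_interpolate[OF B(3,2), of "\<lambda>b. if b = e then 1 else 0"] by blast
    then show "\<exists>c. \<forall>b\<in>B. lc n c b = (if b = e then 1 else 0)" by blast
  qed
  then obtain h where h: "\<And>e b. b \<in> B \<Longrightarrow> lc n (h e) b = (if b = e then 1 else 0)" by metis
  have hV: "h e \<in> V" if "e \<in> E" for e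
  proof -
    have "lc n (h e) (l i) = 0" if "i \<le> k" for i
    proof -
      have "l i \<in> B" using B(1) that by blast
      moreover have "l i \<noteq> e" using \<open>e \<in> E\<close> that by (auto simp: E_def)
      ultimately show ?thesis using h by simp
    qed
    then show ?thesis by (simp add: V_def)
  qed
  \<comment> \<open>A relation between the derivatives is the derivative along the combined
    direction \<open>?c\<close>, whose value on \<open>e\<close> is \<open>f e\<close>.\<close>
  have zero: "f e = 0" if s: "(\<Sum>e\<in>E. scale (f e) (dd n (h e) q)) = 0" and e: "e \<in> E" for f e
  proof (rule ccontr)
    assume "f e \<noteq> 0"
    let ?c = "\<lambda>i. \<Sum>e\<in>E. f e * h e i"
    have E_B: "E \<subseteq> B" by (auto simp: E_def)
    have "lc n ?c e = (\<Sum>e'\<in>E. f e' * (if e = e' then 1 else 0))"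
      unfolding lc_sum_direction using h e E_B by (intro sum.cong) auto
    also have "\<dots> = f e" using e finE by (simp add: if_distrib sum.delta cong: if_cong)
    finally have "lc n ?c e \<noteq> 0" using \<open>f e \<noteq> 0\<close> by simp
    then have "\<exists>i\<le>n. ?c i \<noteq> 0" by (rule lc_nonzero_direction)
    moreover have "lc n ?c (l i) = 0" if "i \<le> k" for i
      unfolding lc_sum_direction using hV that by (intro sum.neutral) (simp add: V_def)
    moreover have "dd n ?c q = 0" using s by (simp only: dd_sum_direction)
    ultimately show False using nondegenerate[of ?c] by (simp add: pm.span_zero)
  qed
  have inj: "inj_on (\<lambda>e. dd n (h e) q) E"
  proof (rule inj_onI, rule ccontr)
    fix x y assume xy: "x \<in> E" "y \<in> E" "dd n (h x) q = dd n (h y) q" "x \<noteq> y"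
    \<comment> \<open>Equal derivatives would give the relation with coefficients 1 and -1, which
      \<open>zero\<close> excludes.\<close>
    let ?f = "\<lambda>e. if e = x then 1 else if e = y then - 1 else 0"
    have "(\<Sum>e\<in>E. scale (?f e) (dd n (h e) q)) = (\<Sum>e\<in>{x, y}. scale (?f e) (dd n (h e) q))"
      using xy finE by (intro sum.mono_neutral_right) auto
    also have "\<dots> = 0" using xy by simp
    finally show False using zero[of ?f x] xy by simp
  qed
  let ?B = "(\<lambda>e. dd n (h e) q) ` E"
  have "pm.independent ?B"
  proof (rule pm.independent_if_scalars_zero)
    fix f x assume s: "(\<Sum>x\<in>?B. scale (f x) x) = 0" and x: "x \<in> ?B"
    then show "f x = 0"
      using zero[of "\<lambda>e. f (dd n (h e) q)"] by (auto simp: sum.reindex[OF inj] comp_def)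
  qed (use finE in simp)
  moreover have "?B \<subseteq> W" using hV by (auto simp: W_def)
  moreover have "card ?B = n - k" by (simp add: card_image inj card_E)
  ultimately show ?thesis unfolding dim_ge_def using finE by (intro exI[of _ ?B]) simp
qed

section \<open>Products of monomials in the \<open>l i\<close> with elements of
  \<open>W\<close>\<close>

lemma l_nonzero: "i \<le> k \<Longrightarrow> l i \<noteq> 0"
  using l_indep pm.dependent_zero by (metis atMost_iff image_eqI)

lemma \<mu>_nonzero: "\<mu> b \<noteq> 0"
  by (simp add: \<mu>_def l_nonzero)

lemma dd_l: "i \<le> k \<Longrightarrow> lc n c (l i) = 0 \<Longrightarrow> dd n c (l i) = 0"
  using l_form[of i] by (simp add: dd_forms_1)

text \<open>Directions in \<open>V\<close> treat the \<open>l i\<close> as constants.\<close>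

lemma dd_\<mu>: "c \<in> V \<Longrightarrow> dd n c (\<mu> b) = 0"
  unfolding \<mu>_def by (rule dd_prod_eq_0) (simp add: V_def dd_power dd_l)

lemma dd_\<mu>_mult:
  assumes "c \<in> V" "w \<in> forms n 1"
  shows "dd n c (\<mu> b * w) = scale (lc n c w) (\<mu> b)"
  using assms by (simp only: dd_mult dd_\<mu> mult_zero_right add_0_right dd_forms_1_mult mult.commute[of "\<mu> b"])

lemma dd_D: "G \<in> D (Suc e) \<Longrightarrow> dd n c G \<in> D e"
proof -
  assume "G \<in> D (Suc e)"
  then have "dd n c G \<in> pm.span ((\<lambda>i. m i ^ e) ` {i \<in> I. lc n c (m i) \<noteq> 0})"
    unfolding D_def using dd_power_span[of I m n] m_form_I by blast
  then show ?thesis unfolding D_def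
    by (rule subsetD[OF pm.span_mono, rotated]) blast
qed

text \<open>Differentiating the given power sum along \<open>c\<close> in \<open>V\<close> only
  replaces \<open>q\<close> by \<open>w\<close>, and the powers that survive belong to points
  indexed by \<open>I\<close>.\<close>

lemma \<mu>_a_mult_W: "w \<in> W \<Longrightarrow> \<mu> a * w \<in> D (N + 1)"
proof -
  assume "w \<in> W"
  then obtain c where c: "c \<in> V" "w = dd n c q" by (auto simp: W_def)
  have "\<mu> a * q \<in> pm.span ((\<lambda>i. m i ^ Suc (N + 1)) ` {..<r})"
    using power_sum by (simp add: \<mu>_def N_def)
  then have span: "dd n c (\<mu> a * q) \<in> pm.span ((\<lambda>i. m i ^ (N + 1)) ` {i \<in> {..<r}. lc n c (m i) \<noteq> 0})"
    by (rule dd_power_span[rotated]) (simp add: m_form del: One_nat_def)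
  have sub: "{i \<in> {..<r}. lc n c (m i) \<noteq> 0} \<subseteq> I" using c(1) by (auto simp: I_def)
  have "dd n c (\<mu> a * q) \<in> D (N + 1)"
    unfolding D_def using pm.span_mono[OF image_mono[OF sub]] span by (rule subsetD)
  then show ?thesis using c by (simp add: dd_mult dd_\<mu>)
qed

text \<open>By the direct sum, \<open>l i\<close> lies outside the span of \<open>W\<close> and the
  other \<open>l j\<close>. Differentiating along \<open>u\<close> lowers the exponent of
  \<open>l i\<close> and leaves everything else alone.\<close>

lemma dual_l:
  assumes "i \<le> k"
  obtains u where "lc n u (l i) = 1" "\<And>j. j \<le> k \<Longrightarrow> j \<noteq> i \<Longrightarrow> lc n u (l j) = 0"
    "\<And>w. w \<in> W \<Longrightarrow> lc n u w = 0"
proof -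
  let ?L = "l ` ({..k} - {i})"
  have "l i \<notin> pm.span (?L \<union> W)"
  proof
    assume "l i \<in> pm.span (?L \<union> W)"
    moreover have "pm.span W = W" using subspace_W by simp
    ultimately obtain x w where xw: "x \<in> pm.span ?L" "w \<in> W" "l i = x + w"
      by (auto simp: pm.span_Un)
    then have x: "x \<in> pm.span (l ` {..k})" using pm.span_mono[of ?L "l ` {..k}"] by blast
    moreover have "l i \<in> pm.span (l ` {..k})" using assms by (simp add: pm.span_base)
    ultimately have "w \<in> pm.span (l ` {..k})" using xw(3) pm.span_diff by (metis add_diff_cancel_left')
    then have "w = 0" using W_span_l xw(2) by blast
    then have "l i \<in> pm.span ?L" using xw by simp
    moreover have "?L = l ` {..k} - {l i}" using l_inj assms by (auto simp: inj_on_def)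
    ultimately show False using l_indep assms unfolding pm.dependent_def by auto
  qed
  moreover have "?L \<union> W \<subseteq> forms n 1" using l_form W_forms by blast
  ultimately obtain u where "lc n u (l i) = 1" "\<And>b. b \<in> ?L \<union> W \<Longrightarrow> lc n u b = 0"
    using separating_functional[of "?L \<union> W" n "l i"] l_form[OF assms] by blast
  then show ?thesis using that by blast
qed

text \<open>The direct sum also keeps \<open>b\<close> outside the span of the \<open>l i\<close>
  and the rest of \<open>B\<close>.\<close>

lemma dual_W:
  assumes B: "pm.independent B" "B \<subseteq> W" and b: "b \<in> B"
  obtains g where "g \<in> V" "lc n g b = 1" "\<And>b'. b' \<in> B \<Longrightarrow> b' \<noteq> b \<Longrightarrow> lc n g b' = 0"
proof -
  let ?L = "l ` {..k}" and ?B = "B - {b}"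
  have "b \<notin> pm.span (?L \<union> ?B)"
  proof
    assume "b \<in> pm.span (?L \<union> ?B)"
    then obtain x w where xw: "x \<in> pm.span ?L" "w \<in> pm.span ?B" "b = x + w"
      by (auto simp: pm.span_Un)
    have "pm.span ?B \<subseteq> W" using B(2) by (intro pm.span_minimal[OF _ subspace_W]) blast
    then have "b - w \<in> W" using xw(2) b B(2) pm.subspace_diff[OF subspace_W] by blast
    moreover have "b - w = x" using xw(3) by simp
    ultimately have "b - w = 0" using W_span_l xw(1) by simp
    then show False using B(1) b xw(2) unfolding pm.dependent_def by auto
  qed
  moreover have "?L \<union> ?B \<subseteq> forms n 1" "b \<in> forms n 1" using l_form W_forms B(2) b by blast+
  ultimately obtain g where "lc n g b = 1" "\<And>x. x \<in> ?L \<union> ?B \<Longrightarrow> lc n g x = 0"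
    using separating_functional[of "?L \<union> ?B" n b] by blast
  then show ?thesis using that[of g] by (auto simp: V_def)
qed

text \<open>Induction on the number of factors missing from \<open>\<mu> a\<close>: put one factor
  \<open>l i\<close> back, then differentiate it away along the dual direction
  \<open>u\<close>.\<close>

lemma \<mu>_mult_W:
  assumes "\<And>i. i \<le> k \<Longrightarrow> b i \<le> a i" "w \<in> W"
  shows "\<mu> b * w \<in> D ((\<Sum>i\<le>k. b i) + 1)"
  using assms
proof (induction "\<Sum>i\<le>k. a i - b i" arbitrary: b w rule: less_induct)
  case less
  show ?case
  proof (cases "\<exists>i\<le>k. b i < a i")
    case False
    then have eq: "b i = a i" if "i \<le> k" for i using less.prems(1) that by force
    then have "\<mu> b = \<mu> a" "(\<Sum>i\<le>k. b i) = N" by (simp_all add: \<mu>_def N_def)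
    then show ?thesis using \<mu>_a_mult_W less.prems(2) by simp
  next
    case True
    then obtain i where i: "i \<le> k" "b i < a i" by blast
    obtain u where u: "lc n u (l i) = 1" "\<And>j. j \<le> k \<Longrightarrow> j \<noteq> i \<Longrightarrow> lc n u (l j) = 0"
      "\<And>w. w \<in> W \<Longrightarrow> lc n u w = 0"
      using dual_l[OF i(1)] by blast
    let ?b = "b(i := Suc (b i))"
    have split: "{..k} = insert i ({..k} - {i})" using i(1) by blast
    have "(\<Sum>j\<le>k. a j - ?b j) < (\<Sum>j\<le>k. a j - b j)"
      using i by (intro sum_strict_mono_ex1) auto
    moreover have "?b j \<le> a j" if "j \<le> k" for j using i less.prems(1) that by auto
    ultimately have "\<mu> ?b * w \<in> D ((\<Sum>j\<le>k. ?b j) + 1)" using less.hyps less.prems(2) by blast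
    moreover have "(\<Sum>j\<le>k. ?b j) = Suc (\<Sum>j\<le>k. b j)"
    proof -
      have "(\<Sum>j\<le>k. ?b j) = ?b i + (\<Sum>j\<in>{..k}-{i}. ?b j)" by (subst split) (subst sum.insert; simp)
      moreover have "(\<Sum>j\<le>k. b j) = b i + (\<Sum>j\<in>{..k}-{i}. b j)" by (subst split) (subst sum.insert; simp)
      moreover have "(\<Sum>j\<in>{..k}-{i}. ?b j) = (\<Sum>j\<in>{..k}-{i}. b j)" by (intro sum.cong) auto
      ultimately show ?thesis by simp
    qed
    ultimately have "dd n u (\<mu> ?b * w) \<in> D ((\<Sum>j\<le>k. b j) + 1)" using dd_D by simp
    moreover have "dd n u (\<mu> ?b * w) = scale (of_nat (Suc (b i))) (\<mu> b * w)"
    proof -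
      let ?P = "\<Prod>j\<in>{..k}-{i}. l j ^ b j"
      have "\<mu> ?b = l i ^ ?b i * (\<Prod>j\<in>{..k}-{i}. l j ^ ?b j)"
        unfolding \<mu>_def by (subst split) (subst prod.insert; simp)
      also have "(\<Prod>j\<in>{..k}-{i}. l j ^ ?b j) = ?P" by (intro prod.cong) auto
      finally have 1: "\<mu> ?b = l i ^ Suc (b i) * ?P" by (simp only: fun_upd_same)
      have 2: "\<mu> b = l i ^ b i * ?P" unfolding \<mu>_def by (subst split) (subst prod.insert; simp)
      have "dd n u w = 0" using u(3)[OF less.prems(2)] W_forms less.prems(2)
        by (auto simp: dd_forms_1 simp del: One_nat_def)
      moreover have "dd n u ?P = 0" using u(2) by (intro dd_prod_eq_0) (auto simp: dd_power dd_l)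
      moreover have "dd n u (l i ^ Suc (b i)) = scale (of_nat (Suc (b i))) (l i ^ b i)"
        using dd_power_form[OF l_form[OF i(1)], of u "b i"] unfolding u(1) mult_1_right .
      ultimately show ?thesis
        by (simp only: 1 2 dd_mult mult_zero_right add_0_right scale_mult_left)
    qed
    \<comment> \<open>Characteristic 0 allows division by the factor \<open>b i + 1\<close> from the
      derivative.\<close>
    ultimately have "scale (inverse (of_nat (Suc (b i)))) (scale (of_nat (Suc (b i))) (\<mu> b * w))
        \<in> D ((\<Sum>j\<le>k. b j) + 1)"
      unfolding D_def by (metis pm.span_scale)
    then show ?thesis by (simp del: of_nat_Suc)
  qed
qed

lemma C_mult_W: "p \<in> C e \<Longrightarrow> w \<in> W \<Longrightarrow> p * w \<in> D (Suc e)"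
  using \<mu>_mult_W by (force simp: C_def)

text \<open>As \<open>k < n\<close>, there is a nonzero \<open>w\<close> in \<open>W\<close>, and a
  direction in \<open>V\<close> with value 1 on \<open>w\<close> maps \<open>p * w\<close> to
  \<open>p\<close>.\<close>

lemma C_D: "C e \<subseteq> D e"
proof
  fix p assume p: "p \<in> C e"
  obtain B where B: "B \<subseteq> W" "pm.independent B" "n - k \<le> card B"
    using dim_W unfolding dim_ge_def by blast
  then obtain w where w: "w \<in> B" using k_less by fastforce
  obtain g where g: "g \<in> V" "lc n g w = 1" using dual_W[OF B(2,1) w] by blast
  have "dd n g (p * w) \<in> D e" using C_mult_W[OF p] w B(1) dd_D by blast
  moreover have "dd n g (p * w) = p"
    using p g w B(1) W_forms by (auto simp: C_def dd_\<mu>_mult simp del: One_nat_def)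
  ultimately show "p \<in> D e" by simp
qed

text \<open>Only a lower bound for the number of monomials of degree \<open>e\<close> in \<open>C e\<close>, but a sufficient one.\<close>

definition \<gamma> :: "nat \<Rightarrow> nat" where
  "\<gamma> e = (if e = 1 then 2 else if e \<le> N then 1 else 0)"

text \<open>Starting from \<open>a\<close>, lower one positive exponent at a time.\<close>

lemma exponent_exists:
  assumes "e \<le> N"
  shows "\<exists>b. (\<forall>i\<le>k. b i \<le> a i) \<and> (\<Sum>i\<le>k. b i) = e"
  using assms
proof (induction "N - e" arbitrary: e)
  case 0
  then show ?case by (intro exI[of _ a]) (simp add: N_def)
next
  case (Suc d)
  then obtain b where b: "\<forall>i\<le>k. b i \<le> a i" "(\<Sum>i\<le>k. b i) = Suc e"
    by (metis Suc_diff_Suc Suc_leI Suc_inject zero_less_Suc zero_less_diff)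
  then obtain i where i: "i \<le> k" "b i \<noteq> 0" by (metis atMost_iff nat.distinct(1) sum.neutral)
  have split: "{..k} = insert i ({..k} - {i})" using i(1) by blast
  let ?b = "b(i := b i - 1)"
  have "(\<Sum>j\<le>k. ?b j) = ?b i + (\<Sum>j\<in>{..k}-{i}. ?b j)" by (subst split) (subst sum.insert; simp)
  moreover have "(\<Sum>j\<le>k. b j) = b i + (\<Sum>j\<in>{..k}-{i}. b j)" by (subst split) (subst sum.insert; simp)
  moreover have "(\<Sum>j\<in>{..k}-{i}. ?b j) = (\<Sum>j\<in>{..k}-{i}. b j)" by (intro sum.cong) auto
  ultimately have "(\<Sum>j\<le>k. ?b j) = e" using b(2) i(2) by simp
  then show ?case using b(1) i(1) by (intro exI[of _ ?b]) (auto simp: le_diff_conv trans_le_add1)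
qed

text \<open>The second monomial in degree 1 is where \<open>0 < k\<close> enters.\<close>

lemma dim_C: "dim_ge (C e) (\<gamma> e)"
proof (cases "e = 1")
  case True
  have "l i \<in> C 1" if "i \<le> k" for i
  proof -
    let ?b = "\<lambda>j. if j = i then 1 else (0::nat)"
    have "\<mu> ?b = (\<Prod>j\<le>k. if j = i then l i else 1)" unfolding \<mu>_def by (intro prod.cong) auto
    then have "l i = \<mu> ?b" using that by (simp add: prod.delta)
    moreover have "(\<Sum>j\<le>k. ?b j) = 1" using that by (simp add: sum.delta)
    moreover have "\<forall>j\<le>k. ?b j \<le> a j" using a_pos by (simp add: Suc_le_eq)
    ultimately show ?thesis unfolding C_def by blast
  qed
  then have "{l 0, l 1} \<subseteq> C 1" using k_pos by simp
  moreover have "pm.independent {l 0, l 1}"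
    using k_pos by (intro pm.independent_mono[OF l_indep]) auto
  moreover have "l 0 \<noteq> l 1" using inj_onD[OF l_inj, of 0 1] k_pos by auto
  ultimately show ?thesis using True unfolding dim_ge_def \<gamma>_def
    by (intro exI[of _ "{l 0, l 1}"]) simp
next
  case False
  show ?thesis
  proof (cases "e \<le> N")
    case True
    then obtain p where "p \<in> C e" using exponent_exists unfolding C_def by blast
    moreover from this have "pm.independent {p}"
      using \<mu>_nonzero by (auto simp: C_def pm.dependent_single)
    ultimately show ?thesis using True False unfolding dim_ge_def \<gamma>_def
      by (intro exI[of _ "{p}"]) simp
  qed (use False in \<open>simp add: \<gamma>_def\<close>)
qed

section \<open>Dimension bounds for kernels and for the spans of powers\<close>

lemma dd_C: "g \<in> V \<Longrightarrow> p \<in> C e \<Longrightarrow> dd n g p = 0"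
  by (auto simp: C_def dd_\<mu>)

lemma dd_C_mult: "g \<in> V \<Longrightarrow> p \<in> C e \<Longrightarrow> w \<in> forms n 1 \<Longrightarrow> dd n g (p * w) = scale (lc n g w) p"
  by (auto simp: C_def dd_\<mu>_mult simp del: One_nat_def)

text \<open>The kernel contains \<open>C (Suc e)\<close> and all \<open>p * b\<close> with
  \<open>p\<close> in \<open>C e\<close> and \<open>b\<close> in \<open>B\<close>. The dual
  directions \<open>g b\<close> separate the elements of \<open>B\<close>, so rank and nullity split
  off \<open>\<gamma> e\<close> dimensions for each \<open>b\<close>.\<close>

lemma dim_kernel:
  assumes t: "t \<in> V" and B: "finite B" "pm.independent B" "B \<subseteq> W" "\<And>w. w \<in> B \<Longrightarrow> lc n t w = 0"
  shows "dim_ge {x \<in> D (Suc e). dd n t x = 0} (card B * \<gamma> e + \<gamma> (Suc e))"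
proof -
  have "\<forall>b\<in>B. \<exists>g\<in>V. lc n g b = 1 \<and> (\<forall>b'\<in>B. b' \<noteq> b \<longrightarrow> lc n g b' = 0)"
    using dual_W[OF B(2,3)] by metis
  then obtain g where g: "\<And>b. b \<in> B \<Longrightarrow> g b \<in> V" "\<And>b. b \<in> B \<Longrightarrow> lc n (g b) b = 1"
    "\<And>b b'. b \<in> B \<Longrightarrow> b' \<in> B \<Longrightarrow> b' \<noteq> b \<Longrightarrow> lc n (g b) b' = 0"
    by metis
  \<comment> \<open>Adding \<open>b\<close> to \<open>S\<close> drops the condition for \<open>g b\<close>, which maps \<open>p * b\<close> to \<open>p\<close>.\<close>
  define E where "E S = {x \<in> D (Suc e). dd n t x = 0 \<and> (\<forall>b\<in>B - S. dd n (g b) x = 0)}" for S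
  have "dim_ge (E S) (card S * \<gamma> e + \<gamma> (Suc e))" if "S \<subseteq> B" for S
    using finite_subset[OF that B(1)] that
  proof (induction S rule: finite_induct)
    case empty
    have "C (Suc e) \<subseteq> E {}" using C_D dd_C t g(1) by (auto simp: E_def)
    then show ?case using dim_ge_mono[OF dim_C] by simp
  next
    case (insert b S)
    then have b: "b \<in> B" "b \<in> forms n 1" using B(3) W_forms by auto
    have "C e \<subseteq> dd n (g b) ` E (insert b S)"
    proof
      fix p assume p: "p \<in> C e"
      have "p * b \<in> D (Suc e)" using C_mult_W[OF p] B(3) b(1) by blast
      moreover have "dd n t (p * b) = 0" using dd_C_mult[OF t p b(2)] B(4)[OF b(1)] by simp
      moreover have "dd n (g b') (p * b) = 0" if "b' \<in> B - insert b S" for b'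
        using dd_C_mult[OF g(1) p b(2), of b'] g(3)[of b' b] b(1) that by auto
      ultimately have "p * b \<in> E (insert b S)" by (simp add: E_def)
      moreover have "dd n (g b) (p * b) = p"
        using dd_C_mult[OF g(1)[OF b(1)] p b(2)] g(2)[OF b(1)] by simp
      ultimately show "p \<in> dd n (g b) ` E (insert b S)" by (metis imageI)
    qed
    then have image: "dim_ge (dd n (g b) ` E (insert b S)) (\<gamma> e)" using dim_ge_mono[OF dim_C] by simp
    have "{x \<in> E (insert b S). dd n (g b) x = 0} = E S"
      using insert.hyps b(1) by (auto simp: E_def)
    then have "dim_ge {x \<in> E (insert b S). dd n (g b) x = 0} (card S * \<gamma> e + \<gamma> (Suc e))"
      using insert.IH insert.prems by simp
    from dim_ge_rank_nullity[OF linear_dd image this]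
    have "dim_ge (E (insert b S)) (\<gamma> e + (card S * \<gamma> e + \<gamma> (Suc e)))" .
    then show ?case using insert.hyps by (simp add: add.assoc)
  qed
  from this[of B] show ?thesis by (rule dim_ge_mono) (auto simp: E_def)
qed

text \<open>As \<open>t\<close> kills none of the points, it maps \<open>D (Suc e)\<close> onto a
  set containing \<open>D e\<close>; rank and nullity then add up the kernels. The second sum stops
  before \<open>e\<close> because a product with an element of \<open>B\<close> uses a monomial of
  degree one less.\<close>

lemma dim_D:
  assumes t: "t \<in> V" "\<And>i. i \<in> I \<Longrightarrow> lc n t (m i) \<noteq> 0"
    and B: "finite B" "pm.independent B" "B \<subseteq> W" "\<And>w. w \<in> B \<Longrightarrow> lc n t w = 0"
  shows "dim_ge (D e) ((\<Sum>j\<le>e. \<gamma> j) + card B * (\<Sum>j<e. \<gamma> j))"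
proof (induction e)
  case 0
  then show ?case using dim_ge_mono[OF dim_C C_D order.refl] by simp
next
  case (Suc e)
  have "m i ^ e \<in> dd n t ` D (Suc e)" if "i \<in> I" for i
  proof
    let ?x = "of_nat (Suc e) * lc n t (m i)"
    have x: "?x \<noteq> 0" using t(2)[OF that] by (simp del: of_nat_Suc)
    show "m i ^ e = dd n t (scale (inverse ?x) (m i ^ Suc e))"
      by (simp only: dd_scale dd_power_form[OF m_form_I[OF that]] pm.scale_scale left_inverse[OF x] pm.scale_one)
    show "scale (inverse ?x) (m i ^ Suc e) \<in> D (Suc e)"
      unfolding D_def by (intro pm.span_scale pm.span_base imageI that)
  qed
  then have "D e \<subseteq> dd n t ` D (Suc e)"
    unfolding D_def[of e]
    by (intro pm.span_minimal) (auto simp: D_def intro!: pp.linear_subspace_image[OF linear_dd])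
  then have "dim_ge (dd n t ` D (Suc e)) ((\<Sum>j\<le>e. \<gamma> j) + card B * (\<Sum>j<e. \<gamma> j))"
    using dim_ge_mono[OF Suc] by simp
  then have "dim_ge (D (Suc e))
      ((\<Sum>j\<le>e. \<gamma> j) + card B * (\<Sum>j<e. \<gamma> j) + (card B * \<gamma> e + \<gamma> (Suc e)))"
    using dim_kernel[OF t(1) B] by (rule dim_ge_rank_nullity[OF linear_dd])
  then show ?case by (simp add: algebra_simps)
qed

text \<open>Each of the \<open>N + 1\<close> degrees counts once, and degree 1, present since
  \<open>1 \<le> N\<close>, counts once more.\<close>

lemma sum_\<gamma>: "(\<Sum>j<N + 1. \<gamma> j) = N + 2"
proof -
  have "1 \<le> N" unfolding N_def using a_pos[of 0] member_le_sum[of 0 "{..k}" a] by simp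
  then have "(\<Sum>j<N + 1. \<gamma> j) = \<gamma> 1 + (\<Sum>j\<in>{..<N + 1} - {1}. \<gamma> j)" by (intro sum.remove) auto
  also have "(\<Sum>j\<in>{..<N + 1} - {1}. \<gamma> j) = (\<Sum>j\<in>{..<N + 1} - {1}. 1)"
    by (intro sum.cong) (auto simp: \<gamma>_def)
  finally show ?thesis using \<open>1 \<le> N\<close> by (simp add: \<gamma>_def)
qed

text \<open>A generic \<open>t\<close> in \<open>V\<close> has a kernel of dimension at least
  \<open>n - k - 1\<close> on \<open>W\<close>. Together with the monomials themselves this gives
  \<open>n - k\<close> copies of the sum of the \<open>\<gamma> j\<close>.\<close>

lemma rank_bound: "(N + 2) * (n - k) \<le> r"
proof -
  have "\<exists>t\<in>V. \<forall>p\<in>m ` I. lc n t p \<noteq> 0"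
    using zero_in_V V_closed finite_I by (intro generic_direction) (auto simp: I_def)
  then obtain t where t: "t \<in> V" "\<And>i. i \<in> I \<Longrightarrow> lc n t (m i) \<noteq> 0" by blast
  obtain B where B: "finite B" "B \<subseteq> {w \<in> W. lc n t w = 0}" "pm.independent B" "n - k - 1 \<le> card B"
    using dim_ge_kernel[OF linear_lc subspace_W dim_W, of n t] unfolding dim_ge_def by (elim exE conjE)
  have "dim_ge (D (N + 1)) ((\<Sum>j\<le>N + 1. \<gamma> j) + card B * (\<Sum>j<N + 1. \<gamma> j))"
    using t B by (intro dim_D) auto
  then have "(\<Sum>j\<le>N + 1. \<gamma> j) + card B * (N + 2) \<le> card ((\<lambda>i. m i ^ (N + 1)) ` I)"
    unfolding D_def sum_\<gamma> by (rule dim_ge_card) (simp_all add: finite_I)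
  also have "\<dots> \<le> card I" by (rule card_image_le[OF finite_I])
  also have "\<dots> \<le> r" using card_mono[of "{..<r}" I] by (auto simp: I_def)
  finally have "(\<Sum>j\<le>N + 1. \<gamma> j) + card B * (N + 2) \<le> r" .
  \<comment> \<open>The summand of degree \<open>N + 1\<close> is discarded.\<close>
  moreover have "N + 2 \<le> (\<Sum>j\<le>N + 1. \<gamma> j)"
    using sum_\<gamma> by (metis Suc_eq_plus1 le_add1 lessThan_Suc_atMost sum.lessThan_Suc)
  moreover have "(N + 2) * (n - k) \<le> (N + 2) * (1 + card B)"
    using B(4) by (intro mult_le_mono2) simp
  ultimately show ?thesis by (simp add: algebra_simps)
qed

end

section \<open>Duality and projective spans\<close>

text \<open>The element of \<open>S\<close> belonging to a direction; it carries statements on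
  \<open>dd\<close> over to \<open>act\<close>, \<open>Ann\<close> and
  \<open>zero_locus\<close>.\<close>

definition form_of :: "nat \<Rightarrow> (nat \<Rightarrow> 'k) \<Rightarrow> 'k::field mpoly" where
  "form_of n c = (\<Sum>i\<le>n. scale (c i) (X i))"

lemma form_of_forms: "form_of n c \<in> forms n 1"
  unfolding form_of_def
  by (intro pm.subspace_sum[OF subspace_forms] pm.subspace_scale[OF subspace_forms] X_forms) simp

lemma lookup_form_of: "i \<le> n \<Longrightarrow> Poly_Mapping.lookup (form_of n c) (var i) = c i"
  by (simp add: form_of_def lookup_sum_pm lookup_X if_distrib sum.delta del: One_nat_def cong: if_cong)

lemma form_of_nonzero: "\<exists>i\<le>n. c i \<noteq> 0 \<Longrightarrow> form_of n c \<noteq> 0"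
  using lookup_form_of by (metis lookup_zero)

lemma inj_var: "inj var"
  by (rule injI) (metis lookup_single_eq lookup_single_not_eq zero_neq_one)

lemma mon_act_var: "mon_act (var i) = partial i"
  by (simp add: mon_act_def)

lemma act_forms_1:
  assumes "H \<in> forms n 1"
  shows "act H p = dd n (\<lambda>i. Poly_Mapping.lookup H (var i)) p"
proof -
  have "Poly_Mapping.keys H \<subseteq> var ` {..n}"
    using lookup_forms_1[OF assms] by (auto simp: in_keys_iff simp del: One_nat_def)
  then have "act H p = (\<Sum>m\<in>var ` {..n}. scale (Poly_Mapping.lookup H m) (mon_act m p))"
    unfolding act_def by (intro sum.mono_neutral_left) (auto simp: in_keys_iff)
  also have "\<dots> = dd n (\<lambda>i. Poly_Mapping.lookup H (var i)) p"
    by (simp only: sum.reindex[OF inj_on_subset[OF inj_var subset_UNIV]] comp_def mon_act_var dd_def)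
  finally show ?thesis .
qed

lemma act_form_of: "act (form_of n c) p = dd n c p"
  using act_forms_1[OF form_of_forms, of n c p] by (simp add: dd_def lookup_form_of del: One_nat_def)

lemma concise_dd:
  assumes "concise n F" "\<exists>i\<le>n. c i \<noteq> 0"
  shows "dd n c F \<noteq> 0"
proof
  assume "dd n c F = 0"
  then have "form_of n c \<in> Ann n F"
    using form_of_forms[of n c] by (simp add: Ann_def act_form_of forms_def)
  then have "form_of n c = 0"
    using assms(1) form_of_forms[of n c] unfolding concise_def by blast
  then show False using form_of_nonzero assms(2) by blast
qed

abbreviation coords :: "'k::field mpoly \<Rightarrow> (nat \<Rightarrow>\<^sub>0 'k)" where
  "coords \<equiv> Poly_Mapping.map_key (\<lambda>i. Poly_Mapping.single i 1)"

lemma lookup_coords: "Poly_Mapping.lookup (coords p) i = Poly_Mapping.lookup p (var i)"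
  using inj_var by (simp add: map_key.rep_eq)

lemma linear_coords: "Vector_Spaces.linear scale scale (coords :: 'k::field mpoly \<Rightarrow> _)"
  by (rule Vector_Spaces.linear_iff[THEN iffD2])
    (auto simp: pm.vector_space_axioms lookup_coords lookup_add intro!: poly_mapping_eqI simp del: One_nat_def)

lemma coords_nonzero:
  assumes "p \<in> forms n 1" "p \<noteq> 0"
  shows "coords p \<noteq> 0"
proof
  assume "coords p = 0"
  then have "Poly_Mapping.lookup p (var i) = 0" for i by (metis lookup_coords lookup_zero)
  then have "p = 0" using forms_1_expand[OF assms(1)] by simp
  then show False using assms(2) by blast
qed

lemma evalp_forms_1:
  assumes "H \<in> forms n 1"
  shows "evalp v H = (\<Sum>i\<le>n. Poly_Mapping.lookup H (var i) * Poly_Mapping.lookup v i)"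
proof -
  let ?g = "\<lambda>m. \<Prod>i\<in>Poly_Mapping.keys m. Poly_Mapping.lookup v i ^ Poly_Mapping.lookup m i"
  have "Poly_Mapping.keys H \<subseteq> var ` {..n}"
    using lookup_forms_1[OF assms] by (auto simp: in_keys_iff simp del: One_nat_def)
  then have "evalp v H = (\<Sum>m\<in>var ` {..n}. Poly_Mapping.lookup H m * ?g m)"
    unfolding evalp_def by (intro sum.mono_neutral_left) (auto simp: in_keys_iff)
  also have "\<dots> = (\<Sum>i\<le>n. Poly_Mapping.lookup H (var i) * ?g (var i))"
    by (simp only: sum.reindex[OF inj_on_subset[OF inj_var subset_UNIV]] comp_def)
  finally show ?thesis by simp
qed

lemma Union_proj_span: "\<Union>(proj_span Z) = pm.span (\<Union>Z) - {0}"
proof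
  show "\<Union>(proj_span Z) \<subseteq> pm.span (\<Union>Z) - {0}"
    by (auto simp: proj_span_def ppt_def pm.span_scale)
  show "pm.span (\<Union>Z) - {0} \<subseteq> \<Union>(proj_span Z)"
  proof
    fix v assume v: "v \<in> pm.span (\<Union>Z) - {0}"
    have "v \<in> ppt v" unfolding ppt_def by (rule CollectI, rule exI[of _ 1]) simp
    then show "v \<in> \<Union>(proj_span Z)" using v by (auto simp: proj_span_def)
  qed
qed

lemma span_dual_pts:
  "pm.span (\<Union>{dual_pt (l i) | i. i \<le> k}) = pm.span (coords ` l ` {..k})"
proof (rule pm.span_eq[THEN iffD2], intro conjI)
  show "\<Union>{dual_pt (l i) | i. i \<le> k} \<subseteq> pm.span (coords ` l ` {..k})"
    by (auto simp: dual_pt_def ppt_def simp del: One_nat_def intro!: pm.span_scale intro: pm.span_base)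
  have "coords (l i) \<in> dual_pt (l i)" for i
    unfolding dual_pt_def ppt_def by (rule CollectI, rule exI[of _ 1]) simp
  then show "coords ` l ` {..k} \<subseteq> pm.span (\<Union>{dual_pt (l i) | i. i \<le> k})"
    by (auto intro!: pm.span_base)
qed

lemma independent_of_image:
  assumes f: "Vector_Spaces.linear scale scale f" and inj: "inj_on f S" and fin: "finite S"
    and indep: "pm.independent (f ` S)"
  shows "pm.independent S"
proof (rule pm.independent_if_scalars_zero[OF fin])
  fix g x assume s: "(\<Sum>x\<in>S. scale (g x) x) = 0" and x: "x \<in> S"
  let ?u = "\<lambda>y. g (inv_into S f y)"
  have "(\<Sum>y\<in>f ` S. scale (?u y) y) = (\<Sum>x\<in>S. scale (g x) (f x))"
    by (simp add: sum.reindex[OF inj] inv_into_f_f[OF inj])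
  also have "\<dots> = f (\<Sum>x\<in>S. scale (g x) x)" by (simp add: pp.linear_sum[OF f] pp.linear_scale[OF f])
  finally have "(\<Sum>y\<in>f ` S. scale (?u y) y) = 0" by (simp add: s pp.linear_0[OF f])
  then have "?u (f x) = 0"
    using pm.independentD[OF indep _ order.refl, of ?u] fin x by simp
  then show "g x = 0" using x by (simp add: inv_into_f_f[OF inj])
qed

text \<open>Only \<open>k + 1\<close> coordinate vectors span a space of dimension
  \<open>k + 1\<close>, so they are distinct and independent; both properties pull back along
  \<open>coords\<close>.\<close>

lemma independent_of_pdim:
  assumes "pdim (proj_span {dual_pt (l i) | i. i \<le> k}) = int k"
  shows "inj_on l {..k} \<and> pm.independent (l ` {..k})"
proof -
  let ?S = "coords ` l ` {..k}"
  have "pm.dim (\<Union>(proj_span {dual_pt (l i) | i. i \<le> k})) = pm.dim ?S"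
    by (rule pm.span_eq_dim) (simp add: Union_proj_span span_dual_pts)
  then have dim: "pm.dim ?S = Suc k" using assms by (simp add: pdim_def)
  obtain B where B: "B \<subseteq> ?S" "pm.independent B" "?S \<subseteq> pm.span B"
    using pm.maximal_independent_subset by blast
  have card_B: "card B = Suc k" using pm.basis_card_eq_dim[OF B(1,3,2)] dim by simp
  have comp: "?S = (coords \<circ> l) ` {..k}" by (simp add: image_comp)
  have "card ?S \<le> Suc k" unfolding comp using card_image_le[of "{..k}" "coords \<circ> l"] by simp
  then have "B = ?S" using B(1) card_B by (intro card_seteq) auto
  then have indep: "pm.independent ?S" and "card ((coords \<circ> l) ` {..k}) = card {..k}"
    using B(2) card_B comp by auto
  then have "inj_on (coords \<circ> l) {..k}" by (intro eq_card_imp_inj_on) auto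
  then have "inj_on l {..k}" "inj_on coords (l ` {..k})"
    by (auto intro: inj_on_imageI2 inj_on_imageI)
  then show ?thesis using independent_of_image[OF linear_coords _ _ indep] by simp
qed

lemma proj_span_zero_locus:
  assumes l: "\<And>i. i \<le> k \<Longrightarrow> l i \<in> forms n 1" and c: "\<And>i. i \<le> k \<Longrightarrow> lc n c (l i) = 0"
  shows "proj_span {dual_pt (l i) | i. i \<le> k} \<subseteq> zero_locus n (form_of n c)"
proof
  fix P assume "P \<in> proj_span {dual_pt (l i) | i. i \<le> k}"
  then obtain v where v: "v \<in> pm.span (coords ` l ` {..k})" "v \<noteq> 0" "P = ppt v"
    unfolding proj_span_def span_dual_pts by blast
  have eval: "evalp w (form_of n c) = (\<Sum>i\<le>n. c i * Poly_Mapping.lookup w i)" for w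
    by (simp add: evalp_forms_1[OF form_of_forms] lookup_form_of del: One_nat_def)
  \<comment> \<open>The vanishing coordinates beyond \<open>n\<close> are recorded too, since
    \<open>zero_locus\<close> asks for points of \<open>proj_space n\<close>.\<close>
  let ?Z = "{w. (\<forall>i>n. Poly_Mapping.lookup w i = 0) \<and> (\<Sum>i\<le>n. c i * Poly_Mapping.lookup w i) = 0}"
  have sub: "pm.subspace ?Z"
  proof (rule pm.subspaceI)
    fix r x assume x: "x \<in> ?Z"
    have "(\<Sum>i\<le>n. c i * Poly_Mapping.lookup (scale r x) i) = r * (\<Sum>i\<le>n. c i * Poly_Mapping.lookup x i)"
      by (simp only: lookup_scale sum_distrib_left mult.left_commute)
    then show "scale r x \<in> ?Z" using x by simp
  qed (simp_all add: lookup_add distrib_left sum.distrib)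
  have "coords (l i) \<in> ?Z" if "i \<le> k" for i
  proof -
    have "Poly_Mapping.lookup (l i) (var j) = 0" if "j > n" for j
      using lookup_forms_1[OF l[OF \<open>i \<le> k\<close>], of "var j"] that
      by (metis injD inj_var leD)
    then show ?thesis using c[OF that] by (simp add: lookup_coords lc_def del: One_nat_def)
  qed
  then have "pm.span (coords ` l ` {..k}) \<subseteq> ?Z" by (intro pm.span_minimal sub) auto
  then have Z: "w \<in> ?Z" if "w \<in> P" for w
    using that v(1,3) pm.subspace_scale[OF sub] by (auto simp: ppt_def)
  have "v \<in> ?Z" using \<open>pm.span (coords ` l ` {..k}) \<subseteq> ?Z\<close> v(1) by blast
  then have "Poly_Mapping.keys v \<subseteq> {..n}" by (auto simp: in_keys_iff not_less[symmetric])
  then have "P \<in> proj_space n" using v(2,3) by (auto simp: proj_space_def)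
  then show "P \<in> zero_locus n (form_of n c)"
    using Z by (simp add: zero_locus_def eval)
qed

lemma dual_pt_in_proj_span:
  assumes "p \<in> forms n 1" "p \<noteq> 0" "p \<in> pm.span (l ` {..k})"
  shows "dual_pt p \<in> proj_span {dual_pt (l i) | i. i \<le> k}"
proof -
  have "coords p \<in> coords ` pm.span (l ` {..k})" using assms(3) by (rule imageI)
  then have "coords p \<in> pm.span (coords ` l ` {..k}) - {0}"
    using coords_nonzero[OF assms(1,2)] by (simp only: pp.linear_span_image[OF linear_coords] Diff_iff) simp
  then show ?thesis unfolding proj_span_def span_dual_pts dual_pt_def[of p] by (rule imageI)
qed

section \<open>Lower bounds for the Waring rank in both cases\<close>

theorem theorem3p3:
  fixes F q :: "'k::{alg_closed_field, field_char_0} mpoly"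
    and l :: "nat \<Rightarrow> 'k mpoly" and a :: "nat \<Rightarrow> nat" and n k :: nat
    and L :: "'k ppoint set"
  assumes l_form: "\<And>i. i \<le> k \<Longrightarrow> l i \<in> forms n 1 \<and> l i \<noteq> 0"
    and l_nonprop: "\<And>i j. i \<le> k \<Longrightarrow> j \<le> k \<Longrightarrow> i \<noteq> j \<Longrightarrow> \<nexists>c. l i = scale c (l j)"
    and a_pos: "\<And>i. i \<le> k \<Longrightarrow> 0 < a i"
    and q_form: "q \<in> forms n 2"
    and F_eq: "F = (\<Prod>i\<le>k. l i ^ a i) * q"
    and F_concise: "concise n F"
    and L_eq: "L = proj_span {dual_pt (l i) | i. i \<le> k}"
    and L_dim: "pdim L = int k"
    and k_less: "k < n"
    and cond_a: "\<And>i H. 2 \<le> i \<Longrightarrow> i \<le> tdeg F - 1 \<Longrightarrow>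
      (\<And>j. j \<in> {1..i} \<Longrightarrow> H j \<in> forms n 1 \<and> H j \<noteq> 0) \<Longrightarrow>
      (\<Prod>j=1..i. H j) \<in> Ann n F \<Longrightarrow> L \<subseteq> zero_locus n (H i) \<Longrightarrow>
      act (\<Prod>j=1..i-1. H j) (\<Prod>j\<le>k. l j ^ a j) = 0"
    and cond_b: "0 < pdim L \<Longrightarrow>
      (\<And>H. H \<in> forms n 1 \<Longrightarrow> H \<noteq> 0 \<Longrightarrow> L \<subseteq> zero_locus n H \<Longrightarrow> dual_pt (act H q) \<notin> L)"
  shows "(pdim L = 0 \<longrightarrow> enat ((tdeg F - 1) * n) \<le> srk n F) \<and>
         (0 < pdim L \<longrightarrow> enat (tdeg F * (n - k)) \<le> srk n F)"
proof -
  let ?A = "\<Prod>i\<le>k. l i ^ a i"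
  let ?N = "\<Sum>i\<le>k. a i"
  have indep: "inj_on l {..k}" "pm.independent (l ` {..k})"
    using independent_of_pdim L_dim unfolding L_eq by blast+
  have "?A \<in> forms n ?N" using l_form forms_power by (intro forms_prod) fastforce
  then have "F \<in> forms n (?N + 2)" unfolding F_eq using q_form by (rule forms_mult)
  \<comment> \<open>Conciseness makes the derivative along the direction with all coefficients 1
    nonzero.\<close>
  moreover have "F \<noteq> 0" using concise_dd[OF F_concise, of "\<lambda>_. 1"] by (metis dd_0 le0 zero_neq_one)
  ultimately have deg: "tdeg F = ?N + 2" by (rule tdeg_form)
  \<comment> \<open>Along a direction killing the \<open>l i\<close> the derivative of
    \<open>F\<close> is \<open>?A * dd n c q\<close>, so conciseness forbids
    \<open>dd n c q = 0\<close>.\<close>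
  have q_nonzero: "dd n c q \<noteq> 0" if c: "\<And>i. i \<le> k \<Longrightarrow> lc n c (l i) = 0" "\<exists>i\<le>n. c i \<noteq> 0" for c
  proof
    assume "dd n c q = 0"
    moreover have "dd n c ?A = 0"
      using l_form c(1) by (intro dd_prod_eq_0) (simp add: dd_power dd_forms_1)
    ultimately have "dd n c F = 0" by (simp add: F_eq dd_mult)
    then show False using concise_dd[OF F_concise c(2)] by blast
  qed
  \<comment> \<open>A bound for every decomposition bounds the infimum in \<open>srk\<close>, which
    is infinite if there is none.\<close>
  have bound: "(pdim L = 0 \<longrightarrow> (tdeg F - 1) * n \<le> r) \<and> (0 < pdim L \<longrightarrow> tdeg F * (n - k) \<le> r)"
    if m: "\<forall>i<r. m i \<in> forms n 1" and F_span: "F \<in> pm.span ((\<lambda>i. m i ^ tdeg F) ` {..<r})" for r m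
  proof (intro conjI impI)
    assume "pdim L = 0"
    then have k: "k = 0" using L_dim by simp
    have "l 0 ^ a 0 * q \<in> pm.span ((\<lambda>i. m i ^ (a 0 + 2)) ` {..<r})"
      using F_span[unfolded deg] by (simp add: F_eq k del: add_2_eq_Suc')
    then have "(a 0 + 1) * n \<le> r"
      using m l_form[of 0] q_nonzero by (intro one_linear_factor_bound[OF _ _ q_form]) (auto simp: k)
    then show "(tdeg F - 1) * n \<le> r" by (simp add: deg k)
  next
    assume pos: "0 < pdim L"
    \<comment> \<open>Otherwise the dual point of the nonzero form \<open>dd n c q\<close> would lie
      in \<open>L\<close>, against condition (b) for \<open>form_of n c\<close>.\<close>
    have nondeg: "dd n c q \<notin> pm.span (l ` {..k})"
      if c: "\<And>i. i \<le> k \<Longrightarrow> lc n c (l i) = 0" "\<exists>i\<le>n. c i \<noteq> 0" for c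
    proof
      assume "dd n c q \<in> pm.span (l ` {..k})"
      moreover have "dd n c q \<in> forms n 1" using q_form by (intro dd_forms) (simp add: numeral_2_eq_2)
      ultimately have "dual_pt (dd n c q) \<in> L"
        unfolding L_eq using q_nonzero[OF c] by (intro dual_pt_in_proj_span)
      moreover have "L \<subseteq> zero_locus n (form_of n c)"
        unfolding L_eq using l_form c(1) by (intro proj_span_zero_locus) auto
      ultimately show False
        using cond_b[OF pos form_of_forms form_of_nonzero[of n c]] c(2) by (simp add: act_form_of)
    qed
    interpret power_sum_setup n k r l a q m
    proof unfold_locales
      show "?A * q \<in> pm.span ((\<lambda>i. m i ^ (?N + 2)) ` {..<r})"
        using F_span unfolding deg by (simp only: F_eq)
      show "0 < k" using pos L_dim by simp
    qed (use l_form indep a_pos k_less q_form m nondeg in auto)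
    show "tdeg F * (n - k) \<le> r" using rank_bound by (simp add: deg N_def)
  qed
  show ?thesis
    unfolding srk_def using bound by (auto intro!: Inf_greatest)
qed

end
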